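(* For a computable Polish space $\mathbf{X}$ with metric $d$, the following are equivalent: (1) $\mathbf{X}$ is computably compact. (2) There are computable sequences $(\varepsilon_i\in\mathbb{Q}^+)_{i\in\mathbb{N}}$ and $(s_i\in\mathbb{N})_{i\in\mathbb{N}}$ such that $\lim_{i\to\infty}\varepsilon_i=0$ and for every $i$, \[ s_i=\sup\{m\in\mathbb{N} : \exists x_1,\ldots,x_m\in\mathbf{X}\ \forall j,k\le m,\ j\ne k:\ d(x_j,x_k)>\varepsilon_i\}.\]
   Context: A computable Polish space is a complete computable metric space: a complete metric space with a designated dense sequence on which the metric is computable, points represented as limits of fast converging sequences from it. $\mathbf{X}$ is computably compact if the set of open sets $U$ (given as unions of rational balls around dense-sequence points) with $U=\mathbf{X}$ is semi-decidable. $\mathbb{Q}^+$ denotes the positive rationals. *)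

theory Defs
  imports "HOL-Analysis.Analysis" "HOL-Library.Nat_Bijection" "HOL-Library.Countable"
    "HOL-Library.Extended_Nat"
begin

(* Partial recursive functions relative to an input stream in nat => nat, which plays the role
   of the input tape of a Type-2 machine and is accessed through Query.  Arguments are passed
   as a list of numbers. *)

datatype prog =
    Zero
  | Succ
  | Proj nat
  | Query
  | Comp prog "prog list"
  | Rec prog prog
  | Mu prog

inductive runs :: "(nat \<Rightarrow> nat) \<Rightarrow> prog \<Rightarrow> nat list \<Rightarrow> nat \<Rightarrow> bool" for p :: "nat \<Rightarrow> nat" where
  runs_Zero: "runs p Zero xs 0"
| runs_Succ: "runs p Succ [x] (Suc x)"
| runs_Proj: "i < length xs \<Longrightarrow> runs p (Proj i) xs (xs ! i)"
| runs_Query: "runs p Query [x] (p x)"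
| runs_Comp: "list_all2 (\<lambda>g y. runs p g xs y) gs ys \<Longrightarrow> runs p f ys z \<Longrightarrow> runs p (Comp f gs) xs z"
| runs_Rec_0: "runs p f xs y \<Longrightarrow> runs p (Rec f g) (0 # xs) y"
| runs_Rec_Suc: "runs p (Rec f g) (n # xs) y \<Longrightarrow> runs p g (n # y # xs) z \<Longrightarrow>
    runs p (Rec f g) (Suc n # xs) z"
| runs_Mu: "runs p f (n # xs) 0 \<Longrightarrow> (\<forall>m<n. \<exists>y. runs p f (m # xs) (Suc y)) \<Longrightarrow>
    runs p (Mu f) xs n"

(* Ordinary computability of total k-ary functions: on the constant zero stream, Query is the
   zero function and adds no computational power. *)

definition computable_fun :: "nat \<Rightarrow> (nat list \<Rightarrow> nat) \<Rightarrow> bool" where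
  "computable_fun k f \<longleftrightarrow> (\<exists>e. \<forall>xs. length xs = k \<longrightarrow> runs (\<lambda>_. 0) e xs (f xs))"

definition computable_nat_seq :: "(nat \<Rightarrow> nat) \<Rightarrow> bool" where
  "computable_nat_seq s \<longleftrightarrow> computable_fun 1 (\<lambda>xs. s (xs ! 0))"

(* nat_to_rat_surj decodes a pair of integer codes (numerator, denominator), with x / 0 = 0. *)

definition computable_rat_seq :: "(nat \<Rightarrow> rat) \<Rightarrow> bool" where
  "computable_rat_seq q \<longleftrightarrow> (\<exists>c. computable_nat_seq c \<and> (\<forall>i. q i = nat_to_rat_surj (c i)))"

definition computable_real_double_seq :: "(nat \<Rightarrow> nat \<Rightarrow> real) \<Rightarrow> bool" where
  "computable_real_double_seq r \<longleftrightarrow>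
    (\<exists>c. computable_fun 3 c \<and>
      (\<forall>i j k. \<bar>real_of_rat (nat_to_rat_surj (c [i, j, k])) - r i j\<bar> \<le> (1 / 2) ^ k))"

locale computable_polish_space =
  fixes a :: "nat \<Rightarrow> 'a::complete_space"
  assumes dense: "closure (range a) = UNIV"
    and computable_dist: "computable_real_double_seq (\<lambda>i j. dist (a i) (a j))"

definition rational_ball :: "(nat \<Rightarrow> 'a::metric_space) \<Rightarrow> nat \<Rightarrow> 'a set" where
  "rational_ball a n = (case prod_decode n of (i, c) \<Rightarrow> ball (a i) (real_of_rat (nat_to_rat_surj c)))"

(* The open set named by a stream.  Balls of nonpositive radius are empty, so a stream may also
   list nothing at a position, and the empty set has names. *)

definition named_open :: "(nat \<Rightarrow> 'a::metric_space) \<Rightarrow> (nat \<Rightarrow> nat) \<Rightarrow> 'a set" where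
  "named_open a p = (\<Union>n. rational_ball a (p n))"

definition semidecidable_open_sets :: "(nat \<Rightarrow> 'a::metric_space) \<Rightarrow> 'a set set \<Rightarrow> bool" where
  "semidecidable_open_sets a S \<longleftrightarrow>
    (\<exists>e. \<forall>p. (\<exists>y. runs p e [] y) \<longleftrightarrow> named_open a p \<in> S)"

definition computably_compact :: "(nat \<Rightarrow> 'a::metric_space) \<Rightarrow> bool" where
  "computably_compact a \<longleftrightarrow> semidecidable_open_sets a {U. open U \<and> U = UNIV}"

end

theory Submission
  imports Defs
begin

text \<open>
  If the space is computably compact, run the semidecision procedure on the list of all balls of radius
  \<open>2 ^ -k\<close> around dense points, cut off after \<open>n\<close> balls; since a halting run reads only finitely many
  balls, some \<open>n\<close> is accepted, which yields computable finite \<open>2 ^ -k\<close>-nets. As a function of the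
  threshold the packing number is antitone with values in the naturals, so it is constant on some
  subinterval of every interval. For a threshold inside such a subinterval, the packing numbers of a fine
  net at a slightly larger and a slightly smaller threshold, computed from approximate distances,
  agree and certify the exact value; search for such a threshold.

  Conversely, a maximal \<open>\<epsilon>\<close>-separated set is an \<open>\<epsilon>\<close>-net, so the space is compact. An open set is then
  recognised to be everything by finding an \<open>\<epsilon>\<close>-separated set of the known maximal size among the dense
  points, such that the closed \<open>\<epsilon>\<close>-balls around its points are formally contained in listed balls.
\<close>

section \<open>Computability relative to an oracle\<close>

named_theorems oracle_intros

text \<open>Total functions computable uniformly in the oracle \<open>p\<close>. The environment \<open>s\<close> may have any type,
  \<open>v s\<close> being the argument list that it presents to the program; hence binders can be handled by
  extending the environment with a pair.\<close>

definition oracle_fun :: "('e \<Rightarrow> nat list) \<Rightarrow> ((nat \<Rightarrow> nat) \<Rightarrow> 'e \<Rightarrow> nat) \<Rightarrow> bool" where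
  "oracle_fun v F \<longleftrightarrow> (\<exists>e. \<forall>p s. runs p e (v s) (F p s))"

definition oracle_pred :: "('e \<Rightarrow> nat list) \<Rightarrow> ((nat \<Rightarrow> nat) \<Rightarrow> 'e \<Rightarrow> bool) \<Rightarrow> bool" where
  "oracle_pred v P \<longleftrightarrow> oracle_fun v (\<lambda>p s. of_bool (P p s))"

definition arity :: "nat \<Rightarrow> ('e \<Rightarrow> nat list) \<Rightarrow> bool" where
  "arity k v \<longleftrightarrow> (\<forall>s. length (v s) = k)"

definition is_arg :: "('e \<Rightarrow> nat list) \<Rightarrow> ('e \<Rightarrow> nat) \<Rightarrow> bool" where
  "is_arg v f \<longleftrightarrow> (\<exists>i. \<forall>s. i < length (v s) \<and> v s ! i = f s)"

lemma arity_intros [oracle_intros]: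
  "arity 0 (\<lambda>s. [])"
  "arity k v \<Longrightarrow> arity (Suc k) (\<lambda>s. h s # v s)"
  "arity k (\<lambda>s. map (f s) [0..<k])"
  by (auto simp: arity_def)

lemma is_arg_hd [oracle_intros]: "is_arg (\<lambda>s. f s # v s) f"
  unfolding is_arg_def by (intro exI[of _ 0]) simp

lemma is_arg_tl: "is_arg v f \<Longrightarrow> is_arg (\<lambda>s. h s # v s) f"
  unfolding is_arg_def by (metis Suc_less_eq length_Cons nth_Cons_Suc)

lemma is_arg_map [oracle_intros]: "i < k \<Longrightarrow> is_arg (\<lambda>s. map (f s) [0..<k]) (\<lambda>s. f s i)"
  unfolding is_arg_def by (intro exI[of _ i]) simp

lemma oracle_fun_var: "is_arg v f \<Longrightarrow> oracle_fun v (\<lambda>p. f)"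
  unfolding is_arg_def oracle_fun_def by (metis runs_Proj)

text \<open>Kept out of \<open>oracle_intros\<close> so that they are listed last:
  \<open>oracle_fun_var\<close> unifies with every goal whose body does not mention the oracle, and
  \<open>is_arg_tl\<close> should yield to \<open>is_arg_hd\<close>.\<close>

lemmas arg_intros = is_arg_tl oracle_fun_var

text \<open>A program sees an environment only through its argument list. So \<open>H\<close> may
  pass to an environment of another type, provided that programs \<open>Gs\<close> compute the
  entries of the new list; \<open>Comp\<close> does the rest.\<close>

lemma oracle_fun_comp:
  assumes F: "oracle_fun w F" and Gs: "\<And>G. G \<in> set Gs \<Longrightarrow> oracle_fun v G"
    and w: "\<And>p s. w (H p s) = map (\<lambda>G. G p s) Gs"
  shows "oracle_fun v (\<lambda>p s. F p (H p s))"
proof -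
  obtain e where e: "\<And>p s. runs p e (w s) (F p s)" using F by (auto simp: oracle_fun_def)
  have "\<forall>G\<in>set Gs. \<exists>c. \<forall>p s. runs p c (v s) (G p s)"
    using Gs by (auto simp: oracle_fun_def)
  then obtain c where c: "\<And>G p s. G \<in> set Gs \<Longrightarrow> runs p (c G) (v s) (G p s)"
    by metis
  have "runs p (Comp e (map c Gs)) (v s) (F p (H p s))" for p s
  proof (rule runs_Comp)
    show "list_all2 (\<lambda>g. runs p g (v s)) (map c Gs) (map (\<lambda>G. G p s) Gs)"
      using c by (auto simp: list_all2_conv_all_nth)
    show "runs p e (map (\<lambda>G. G p s) Gs) (F p (H p s))"
      using e[of p "H p s"] by (simp add: w)
  qed
  then show ?thesis unfolding oracle_fun_def by blast
qed

lemma oracle_fun_comp1: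
  assumes "oracle_fun (\<lambda>x. [x]) F" "oracle_fun v A"
  shows "oracle_fun v (\<lambda>p s. F p (A p s))"
  by (rule oracle_fun_comp[where Gs = "[A]", OF assms(1)]) (use assms in auto)

lemma oracle_fun_comp2:
  assumes "oracle_fun (\<lambda>t. [fst t, snd t]) (\<lambda>p t. F p (fst t) (snd t))" "oracle_fun v A" "oracle_fun v B"
  shows "oracle_fun v (\<lambda>p s. F p (A p s) (B p s))"
  using oracle_fun_comp[where Gs = "[A, B]" and H = "\<lambda>p s. (A p s, B p s)" and v = v, OF assms(1)] assms
  by auto

lemma oracle_fun_comp3:
  assumes "oracle_fun (\<lambda>t. [fst t, fst (snd t), snd (snd t)]) (\<lambda>p t. F p (fst t) (fst (snd t)) (snd (snd t)))"
    "oracle_fun v A" "oracle_fun v B" "oracle_fun v C"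
  shows "oracle_fun v (\<lambda>p s. F p (A p s) (B p s) (C p s))"
  using oracle_fun_comp[where Gs = "[A, B, C]" and H = "\<lambda>p s. (A p s, B p s, C p s)" and v = v, OF assms(1)] assms
  by auto

lemma oracle_fun_subst:
  assumes "oracle_fun (\<lambda>s. map s [0..<m]) F" "\<And>i. i < m \<Longrightarrow> oracle_fun v (G i)"
  shows "oracle_fun v (\<lambda>p s. F p (\<lambda>i. G i p s))"
  by (rule oracle_fun_comp[where Gs = "map G [0..<m]", OF assms(1)]) (use assms in auto)

lemma oracle_fun_nth: "arity k v \<Longrightarrow> i < k \<Longrightarrow> oracle_fun v (\<lambda>p s. v s ! i)"
  by (intro oracle_fun_var) (auto simp: is_arg_def arity_def)

lemma oracle_fun_rec [oracle_intros]:
  assumes k: "arity k v" and A: "oracle_fun v A"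
    and G: "oracle_fun (\<lambda>t. fst (snd t) # snd (snd t) # v (fst t))
              (\<lambda>p t. G p (fst t) (fst (snd t)) (snd (snd t)))"
    and N: "oracle_fun v N"
  shows "oracle_fun v (\<lambda>p s. rec_nat (A p s) (\<lambda>n y. G p s n y) (N p s))"
proof -
  obtain a where a: "\<And>p s. runs p a (v s) (A p s)" using A by (auto simp: oracle_fun_def)
  obtain g where g: "\<And>p s n y. runs p g (n # y # v s) (G p s n y)"
    using G by (auto simp: oracle_fun_def)
  have "runs p (Rec a g) (n # v s) (rec_nat (A p s) (G p s) n)" for p s n
    by (induction n) (auto intro: runs.intros a g)
  then have *: "oracle_fun (\<lambda>t. snd t # v (fst t)) (\<lambda>p t. rec_nat (A p (fst t)) (G p (fst t)) (snd t))"
    unfolding oracle_fun_def by auto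
  \<comment> \<open>\<open>Rec\<close> expects the counter in front of the parameters. The
    composition supplies \<open>N\<close> and copies every parameter by a projection, for which the
    number of parameters must be fixed.\<close>
  let ?Gs = "N # map (\<lambda>i p s. v s ! i) [0..<k]"
  have "oracle_fun v (\<lambda>p s. rec_nat (A p (fst (s, N p s))) (G p (fst (s, N p s))) (snd (s, N p s)))"
  proof (rule oracle_fun_comp[where Gs = ?Gs and H = "\<lambda>p s. (s, N p s)", OF *])
    show "oracle_fun v H" if "H \<in> set ?Gs" for H using that N oracle_fun_nth[OF k] by auto
    show "snd (s, N p s) # v (fst (s, N p s)) = map (\<lambda>G. G p s) ?Gs" for p s
      using k by (auto simp: arity_def intro!: nth_equalityI)
  qed
  then show ?thesis by simp
qed

lemma oracle_fun_LEAST [oracle_intros]: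
  assumes P: "oracle_pred (\<lambda>t. snd t # v (fst t)) (\<lambda>p t. P p (fst t) (snd t))"
    and ex: "\<And>p s. \<exists>n. P p s n"
  shows "oracle_fun v (\<lambda>p s. LEAST n. P p s n)"
proof -
  obtain e where e: "\<And>p s n. runs p e (n # v s) (of_bool (P p s n))"
    using P by (auto simp: oracle_fun_def oracle_pred_def)
  \<comment> \<open>\<open>Mu\<close> stops at the value 0, so truth values are flipped: 1 in the
    base case, 0 at successors.\<close>
  let ?not = "Rec (Comp Succ [Zero]) Zero"
  have not: "runs p ?not [of_bool b] (of_bool (\<not> b))" for p b
  proof (cases b)
    case True
    have "runs p ?not [Suc 0] 0"
    proof (rule runs_Rec_Suc)
      show "runs p (Rec (Comp Succ [Zero]) Zero) [0] 1"
        by (rule runs_Rec_0, rule runs_Comp[where ys="[0]"]) (auto intro: runs.intros)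
    qed (rule runs_Zero)
    then show ?thesis using True by simp
  next
    case False
    have "runs p ?not [0] 1"
      by (rule runs_Rec_0, rule runs_Comp[where ys="[0]"]) (auto intro: runs.intros)
    then show ?thesis using False by simp
  qed
  have ne: "runs p (Comp ?not [e]) (n # v s) (of_bool (\<not> P p s n))" for p s n
    by (rule runs_Comp[where ys="[of_bool (P p s n)]"]) (use e not in auto)
  have "runs p (Mu (Comp ?not [e])) (v s) (LEAST n. P p s n)" for p s
  proof (rule runs_Mu)
    have "P p s (LEAST n. P p s n)" using ex by (metis LeastI)
    then show "runs p (Comp ?not [e]) ((LEAST n. P p s n) # v s) 0"
      using ne[of p "LEAST n. P p s n" s] by simp
    show "\<forall>m<LEAST n. P p s n. \<exists>y. runs p (Comp ?not [e]) (m # v s) (Suc y)"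
    proof (intro allI impI)
      fix m assume "m < (LEAST n. P p s n)"
      then have "\<not> P p s m" using not_less_Least by blast
      then show "\<exists>y. runs p (Comp ?not [e]) (m # v s) (Suc y)"
        using ne[of p m s] by (intro exI[of _ 0]) simp
    qed
  qed
  then show ?thesis unfolding oracle_fun_def by blast
qed

section \<open>Closure under arithmetic, logical connectives and bounded quantifiers\<close>

lemma oracle_fun_Suc [oracle_intros]: "oracle_fun v A \<Longrightarrow> oracle_fun v (\<lambda>p s. Suc (A p s))"
  by (rule oracle_fun_comp1) (auto simp: oracle_fun_def intro: runs.intros)

lemma oracle_fun_query [oracle_intros]: "oracle_fun v A \<Longrightarrow> oracle_fun v (\<lambda>p s. p (A p s))"
  by (rule oracle_fun_comp1[where F="\<lambda>p. p"]) (auto simp: oracle_fun_def intro: runs.intros)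

lemma oracle_fun_const [oracle_intros]: "oracle_fun v (\<lambda>p s. c)"
proof (induction c)
  case 0 then show ?case by (auto simp: oracle_fun_def intro: runs.intros)
qed (rule oracle_fun_Suc)

lemma oracle_fun_add [oracle_intros]:
  assumes "oracle_fun v A" "oracle_fun v B" shows "oracle_fun v (\<lambda>p s. A p s + B p s)"
proof (rule oracle_fun_comp2[OF _ assms])
  have "x + y = rec_nat x (\<lambda>n z. Suc z) y" for x y :: nat by (induction y) auto
  then show "oracle_fun (\<lambda>t. [fst t, snd t]) (\<lambda>p t. fst t + snd t)"
    by (simp only:) (rule oracle_intros arg_intros)+
qed

lemma oracle_fun_mult [oracle_intros]:
  assumes "oracle_fun v A" "oracle_fun v B" shows "oracle_fun v (\<lambda>p s. A p s * B p s)"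
proof (rule oracle_fun_comp2[OF _ assms])
  have "x * y = rec_nat 0 (\<lambda>n z. z + x) y" for x y :: nat by (induction y) auto
  then show "oracle_fun (\<lambda>t. [fst t, snd t]) (\<lambda>p t. fst t * snd t)"
    by (simp only:) (rule oracle_intros arg_intros)+
qed

lemma oracle_fun_power [oracle_intros]:
  assumes "oracle_fun v A" "oracle_fun v B" shows "oracle_fun v (\<lambda>p s. A p s ^ B p s)"
proof (rule oracle_fun_comp2[OF _ assms])
  have "x ^ y = rec_nat 1 (\<lambda>n z. z * x) y" for x y :: nat by (induction y) auto
  then show "oracle_fun (\<lambda>t. [fst t, snd t]) (\<lambda>p t. fst t ^ snd t)"
    by (simp only:) (rule oracle_intros arg_intros)+
qed

lemma oracle_fun_diff [oracle_intros]:
  assumes "oracle_fun v A" "oracle_fun v B" shows "oracle_fun v (\<lambda>p s. A p s - B p s)"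
proof (rule oracle_fun_comp2[OF _ assms])
  have pred: "rec_nat 0 (\<lambda>n y. n) z = z - 1" for z :: nat by (induction z) auto
  have "x - y = rec_nat x (\<lambda>n z. rec_nat 0 (\<lambda>n y. n) z) y" for x y :: nat
    by (induction y) (simp_all add: pred)
  then show "oracle_fun (\<lambda>t. [fst t, snd t]) (\<lambda>p t. fst t - snd t)"
    by (simp only:) (rule oracle_intros arg_intros)+
qed

lemma oracle_pred_le [oracle_intros]:
  assumes "oracle_fun v A" "oracle_fun v B" shows "oracle_pred v (\<lambda>p s. A p s \<le> B p s)"
proof -
  have "of_bool (A p s \<le> B p s) = 1 - (A p s - B p s)" for p s by auto
  then show ?thesis by (simp only: oracle_pred_def) (rule oracle_intros assms)+
qed

lemma oracle_pred_less [oracle_intros]: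
  assumes "oracle_fun v A" "oracle_fun v B" shows "oracle_pred v (\<lambda>p s. A p s < B p s)"
  unfolding less_eq_Suc_le by (rule oracle_intros assms)+

lemma oracle_pred_not [oracle_intros]:
  assumes "oracle_pred v P" shows "oracle_pred v (\<lambda>p s. \<not> P p s)"
proof -
  have "of_bool (\<not> P p s) = 1 - (of_bool (P p s) :: nat)" for p s by auto
  then show ?thesis
    by (simp only: oracle_pred_def) (rule oracle_intros assms[unfolded oracle_pred_def])+
qed

lemma oracle_pred_conj [oracle_intros]:
  assumes "oracle_pred v P" "oracle_pred v Q" shows "oracle_pred v (\<lambda>p s. P p s \<and> Q p s)"
  unfolding oracle_pred_def of_bool_conj by (rule oracle_intros assms[unfolded oracle_pred_def])+

lemma oracle_pred_disj [oracle_intros]: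
  assumes "oracle_pred v P" "oracle_pred v Q" shows "oracle_pred v (\<lambda>p s. P p s \<or> Q p s)"
proof -
  have "oracle_pred v (\<lambda>p s. \<not> (\<not> P p s \<and> \<not> Q p s))" by (rule oracle_intros assms)+
  then show ?thesis by simp
qed

lemma oracle_pred_eq [oracle_intros]:
  assumes "oracle_fun v A" "oracle_fun v B" shows "oracle_pred v (\<lambda>p s. A p s = B p s)"
  unfolding eq_iff by (rule oracle_intros assms)+

lemma oracle_fun_if [oracle_intros]:
  assumes "oracle_pred v P" "oracle_fun v A" "oracle_fun v B"
  shows "oracle_fun v (\<lambda>p s. if P p s then A p s else B p s)"
proof -
  have "(if P p s then A p s else B p s) = of_bool (P p s) * A p s + (1 - of_bool (P p s)) * B p s"
    for p s by auto
  then show ?thesis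
    by (simp only: oracle_pred_def) (rule oracle_intros assms[unfolded oracle_pred_def])+
qed

text \<open>The bound makes an unbounded search total: it stops at \<open>N\<close> at the latest,
  and stops earlier exactly when there is a witness. The existing program for \<open>N\<close> is
  reused in the extended environment by projecting the search variable away.\<close>

lemma oracle_pred_bex [oracle_intros]:
  assumes "arity k v" "oracle_fun v N"
    and P: "oracle_pred (\<lambda>t. snd t # v (fst t)) (\<lambda>p t. P p (fst t) (snd t))"
  shows "oracle_pred v (\<lambda>p s. \<exists>n<N p s. P p s n)"
proof -
  have "(\<exists>n<N. Q n) \<longleftrightarrow> (LEAST n. N \<le> n \<or> Q n) < N" for N :: nat and Q
  proof
    assume "\<exists>n<N. Q n"
    then show "(LEAST n. N \<le> n \<or> Q n) < N" by (metis (mono_tags, lifting) Least_le le_less_trans)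
  next
    assume "(LEAST n. N \<le> n \<or> Q n) < N"
    then show "\<exists>n<N. Q n"
      using LeastI[of "\<lambda>n. N \<le> n \<or> Q n" N] by auto
  qed
  moreover have "oracle_fun (\<lambda>t. snd t # v (fst t)) (\<lambda>p t. N p (fst t))"
  proof -
    let ?Gs = "map (\<lambda>i p t. (snd t # v (fst t)) ! Suc i) [0..<k]"
    show ?thesis
    proof (rule oracle_fun_comp[where Gs = ?Gs and H = "\<lambda>p. fst", OF \<open>oracle_fun v N\<close>])
      show "oracle_fun (\<lambda>t. snd t # v (fst t)) H" if "H \<in> set ?Gs" for H
        using that \<open>arity k v\<close> oracle_fun_nth[of "Suc k" "\<lambda>t. snd t # v (fst t)"]
        by (fastforce simp: arity_def)
      show "v (fst t) = map (\<lambda>G. G p t) ?Gs" for p :: "nat \<Rightarrow> nat" and t :: "'a \<times> nat"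
        using \<open>arity k v\<close> by (auto simp: arity_def intro!: nth_equalityI)
    qed
  qed
  ultimately show ?thesis
    by (simp only:) (rule oracle_intros arg_intros assms(2) P exI disjI1 order_refl | assumption)+
qed

lemma oracle_pred_ball [oracle_intros]:
  assumes "arity k v" "oracle_fun v N"
    and P: "oracle_pred (\<lambda>t. snd t # v (fst t)) (\<lambda>p t. P p (fst t) (snd t))"
  shows "oracle_pred v (\<lambda>p s. \<forall>n<N p s. P p s n)"
proof -
  have "oracle_pred v (\<lambda>p s. \<not> (\<exists>n<N p s. \<not> P p s n))" by (rule oracle_intros assms)+
  then show ?thesis by simp
qed

lemma oracle_fun_div [oracle_intros]:
  assumes "oracle_fun v A" "oracle_fun v B" shows "oracle_fun v (\<lambda>p s. A p s div B p s)"
proof (rule oracle_fun_comp2[OF _ assms])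
  \<comment> \<open>The disjunct \<open>y = 0\<close> keeps the search total and lets it return 0,
    the value of \<open>x div 0\<close>.\<close>
  have ex: "\<exists>q. y = 0 \<or> x < Suc q * y" for x y :: nat
    by (intro exI[of _ x]) (cases y, auto)
  have "x div y = (LEAST q. y = 0 \<or> x < Suc q * y)" for x y :: nat
  proof (cases "y = 0")
    case False
    then have "x < Suc q * y \<longleftrightarrow> x div y \<le> q" for q
      using div_less_iff_less_mult[of y x "Suc q"] by (simp add: less_Suc_eq_le)
    with False show ?thesis by (intro Least_equality[symmetric]) auto
  qed simp
  then show "oracle_fun (\<lambda>t. [fst t, snd t]) (\<lambda>p t. fst t div snd t)"
    by (simp only:) (rule oracle_intros arg_intros ex)+
qed

lemma oracle_fun_mod [oracle_intros]:
  assumes "oracle_fun v A" "oracle_fun v B" shows "oracle_fun v (\<lambda>p s. A p s mod B p s)"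
  unfolding minus_div_mult_eq_mod[symmetric] by (rule oracle_intros assms)+

section \<open>Computability of the Cantor pairing and its projections\<close>

lemma oracle_fun_prod_encode [oracle_intros]:
  assumes "oracle_fun v A" "oracle_fun v B" shows "oracle_fun v (\<lambda>p s. prod_encode (A p s, B p s))"
  unfolding prod_encode_def triangle_def prod.case by (rule oracle_intros assms)+

text \<open>The least \<open>r\<close> is the diagonal \<open>x + y\<close> of the Cantor
  enumeration on which \<open>n\<close> lies; \<open>triangle r\<close> is the code at which this
  diagonal starts.\<close>

lemma prod_decode_LEAST:
  "fst (prod_decode n) = n - triangle (LEAST r. n < triangle (Suc r))"
  "snd (prod_decode n) = (LEAST r. n < triangle (Suc r)) - fst (prod_decode n)"
proof -
  obtain x y where xy: "prod_decode n = (x, y)" by (cases "prod_decode n")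
  then have n: "n = triangle (x + y) + x"
    using prod_decode_inverse[of n] by (simp add: prod_encode_def)
  have "mono triangle" by (intro incseq_SucI) simp
  then have "x + y \<le> r" if "n < triangle (Suc r)" for r
    using that n monoD[of triangle "Suc r" "x + y"] by linarith
  moreover have "n < triangle (Suc (x + y))" using n by simp
  ultimately have "(LEAST r. n < triangle (Suc r)) = x + y"
    by (intro Least_equality)
  moreover have "n - triangle (x + y) = x" using n by simp
  ultimately show "fst (prod_decode n) = n - triangle (LEAST r. n < triangle (Suc r))"
    "snd (prod_decode n) = (LEAST r. n < triangle (Suc r)) - fst (prod_decode n)"
    by (simp_all only: xy fst_conv snd_conv diff_add_inverse)
qed

lemma ex_triangle: "\<exists>r. n < triangle (Suc r)"
  by (intro exI[of _ n]) simp

lemma oracle_fun_prod_decode [oracle_intros]: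
  assumes "oracle_fun v A"
  shows "oracle_fun v (\<lambda>p s. fst (prod_decode (A p s)))" "oracle_fun v (\<lambda>p s. snd (prod_decode (A p s)))"
proof -
  have *: "oracle_fun (\<lambda>t. [t]) (\<lambda>p t. LEAST r. t < triangle (Suc r))"
    unfolding triangle_def by (rule oracle_intros arg_intros ex_triangle[unfolded triangle_def])+
  have **: "oracle_fun (\<lambda>t. [t]) (\<lambda>p t. fst (prod_decode t))"
    unfolding prod_decode_LEAST triangle_def
    by (rule oracle_intros arg_intros ex_triangle[unfolded triangle_def])+
  have "oracle_fun (\<lambda>t. [t]) (\<lambda>p t. snd (prod_decode t))"
    unfolding prod_decode_LEAST(2) by (rule * ** oracle_intros arg_intros)+
  then show "oracle_fun v (\<lambda>p s. fst (prod_decode (A p s)))" "oracle_fun v (\<lambda>p s. snd (prod_decode (A p s)))"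
    using ** by (auto intro: oracle_fun_comp1 assms)
qed

section \<open>Finite use and evaluation with fuel\<close>

text \<open>Ordinary computability is defined on the zero stream. Replacing queries by
  \<open>Zero\<close> makes a program give the same results under every oracle, so computable data
  can be used inside oracle computations.\<close>

primrec unquery :: "prog \<Rightarrow> prog" where
  "unquery Zero = Zero"
| "unquery Succ = Succ"
| "unquery (Proj i) = Proj i"
| "unquery Query = Zero"
| "unquery (Comp f gs) = Comp (unquery f) (map unquery gs)"
| "unquery (Rec f g) = Rec (unquery f) (unquery g)"
| "unquery (Mu f) = Mu (unquery f)"

lemma runs_unquery: "runs (\<lambda>_. 0) e xs y \<Longrightarrow> runs p (unquery e) xs y"
proof (induction rule: runs.induct)
  case (runs_Comp xs gs ys f z)
  then show ?case
    by (auto simp: list_all2_map1 intro!: runs.runs_Comp elim!: list_all2_mono)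
next
  case (runs_Mu f n xs)
  then show ?case by (simp add: runs.runs_Mu) (metis runs.runs_Mu)
qed (auto intro: runs.intros)

lemma oracle_fun_computable_fun:
  assumes "computable_fun k f" "\<And>s. length (v s) = k"
  shows "oracle_fun v (\<lambda>p s. f (v s))"
  using assms unfolding computable_fun_def oracle_fun_def by (metis runs_unquery)

lemma oracle_fun_computable_nat_seq:
  assumes "computable_nat_seq c" "oracle_fun v A"
  shows "oracle_fun v (\<lambda>p s. c (A p s))"
  by (rule oracle_fun_comp1[OF _ assms(2)])
    (use oracle_fun_computable_fun[OF assms(1)[unfolded computable_nat_seq_def], of "\<lambda>x. [x]"] in simp)

lemma computable_nat_seqI: "oracle_fun (\<lambda>x. [x]) (\<lambda>p. f) \<Longrightarrow> computable_nat_seq f"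
  unfolding computable_nat_seq_def computable_fun_def oracle_fun_def
  by (metis One_nat_def length_0_conv length_Suc_conv nth_Cons_0)

text \<open>Evaluation with fuel: the result \<open>0\<close> means no value, \<open>Suc y\<close> means value \<open>y\<close>. Only the unbounded
  search consumes fuel, all other constructs being structural.\<close>

primrec fuel_eval :: "(nat \<Rightarrow> nat) \<Rightarrow> nat \<Rightarrow> prog \<Rightarrow> nat list \<Rightarrow> nat" where
  "fuel_eval q t Zero = (\<lambda>xs. 1)"
| "fuel_eval q t Succ = (\<lambda>xs. if length xs = 1 then Suc (Suc (xs ! 0)) else 0)"
| "fuel_eval q t (Proj i) = (\<lambda>xs. if i < length xs then Suc (xs ! i) else 0)"
| "fuel_eval q t Query = (\<lambda>xs. if length xs = 1 then Suc (q (xs ! 0)) else 0)"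
| "fuel_eval q t (Comp f gs) = (\<lambda>xs. let ys = map (\<lambda>g. g xs) (map (fuel_eval q t) gs) in
     if 0 \<in> set ys then 0 else fuel_eval q t f (map (\<lambda>y. y - 1) ys))"
| "fuel_eval q t (Rec f g) = (\<lambda>xs. case xs of [] \<Rightarrow> 0 | n # xs' \<Rightarrow>
     rec_nat (fuel_eval q t f xs') (\<lambda>m y. if y = 0 then 0 else fuel_eval q t g (m # (y - 1) # xs')) n)"
| "fuel_eval q t (Mu f) = (\<lambda>xs.
     if \<exists>n<t. fuel_eval q t f (n # xs) = 1 \<and> (\<forall>m<n. 1 < fuel_eval q t f (m # xs))
     then Suc (LEAST n. t \<le> n \<or> fuel_eval q t f (n # xs) = 1) else 0)"

text \<open>The disjunct \<open>t \<le> n\<close> in the definition makes the search total, as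
  \<open>oracle_fun_LEAST\<close> demands; under the guard the minimum is the first zero of
  \<open>f\<close>, with all earlier values defined and positive.\<close>

lemma fuel_eval_Mu_eq_Suc:
  "fuel_eval q t (Mu f) xs = Suc n \<longleftrightarrow>
    n < t \<and> fuel_eval q t f (n # xs) = 1 \<and> (\<forall>m<n. 1 < fuel_eval q t f (m # xs))"
proof -
  have *: "(LEAST n. t \<le> n \<or> fuel_eval q t f (n # xs) = 1) = n"
    if "n < t" "fuel_eval q t f (n # xs) = 1" "\<forall>m<n. 1 < fuel_eval q t f (m # xs)" for n
    using that by (intro Least_equality) (auto simp: not_less[symmetric])
  show ?thesis using * by (auto split: if_splits)
qed

lemma fuel_eval_Comp_eq_Suc:
  "fuel_eval q t (Comp f gs) xs = Suc z \<longleftrightarrow>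
    (\<exists>ys. list_all2 (\<lambda>g y. fuel_eval q t g xs = Suc y) gs ys \<and> fuel_eval q t f ys = Suc z)"
proof -
  have "0 \<notin> (\<lambda>g. fuel_eval q t g xs) ` set gs \<and> map (\<lambda>g. fuel_eval q t g xs - 1) gs = ys \<longleftrightarrow>
    list_all2 (\<lambda>g y. fuel_eval q t g xs = Suc y) gs ys" for ys
  proof (induction gs arbitrary: ys)
    case (Cons g gs)
    show ?case by (cases ys) (auto simp flip: Cons.IH)
  qed auto
  moreover have "fuel_eval q t (Comp f gs) xs = Suc z \<longleftrightarrow>
    (\<exists>ys. (0 \<notin> (\<lambda>g. fuel_eval q t g xs) ` set gs \<and> map (\<lambda>g. fuel_eval q t g xs - 1) gs = ys)
      \<and> fuel_eval q t f ys = Suc z)"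
    by (simp add: image_image Let_def comp_def)
  ultimately show ?thesis by simp
qed

text \<open>The fuel stays the same in all recursive calls, so structural induction on the program
  suffices, with an inner induction on the counter for \<open>Rec\<close>.\<close>

lemma runs_if_fuel_eval: "fuel_eval p t e xs = Suc y \<Longrightarrow> runs p e xs y"
proof (induction e arbitrary: xs y)
  case (Comp f gs)
  from Comp.prems obtain ys where ys: "list_all2 (\<lambda>g y. fuel_eval p t g xs = Suc y) gs ys"
      "fuel_eval p t f ys = Suc y"
    unfolding fuel_eval_Comp_eq_Suc by blast
  have "list_all2 (\<lambda>g y. runs p g xs y) gs ys"
    by (rule list.rel_mono_strong[OF ys(1)]) (auto intro: Comp.IH)
  then show ?case using Comp.IH(1)[OF ys(2)] by (rule runs_Comp)
next
  case (Rec f g)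
  then obtain n xs' where xs: "xs = n # xs'" by (cases xs) auto
  let ?r = "rec_nat (fuel_eval p t f xs') (\<lambda>m y. if y = 0 then 0 else fuel_eval p t g (m # (y - 1) # xs'))"
  have "?r n = Suc y \<Longrightarrow> runs p (Rec f g) (n # xs') y" for y
  proof (induction n arbitrary: y)
    case 0
    then show ?case using Rec.IH(1) by (auto intro: runs_Rec_0)
  next
    case (Suc n)
    then obtain z where z: "?r n = Suc z" by (cases "?r n") auto
    with Suc.prems have "fuel_eval p t g (n # z # xs') = Suc y" by simp
    with Suc.IH[OF z] Rec.IH(2) show ?case by (auto intro: runs_Rec_Suc)
  qed
  then show ?case using Rec.prems by (simp add: xs)
next
  case (Mu f)
  from Mu.prems have n: "fuel_eval p t f (y # xs) = Suc 0" "\<And>m. m < y \<Longrightarrow> 1 < fuel_eval p t f (m # xs)"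
    unfolding fuel_eval_Mu_eq_Suc by auto
  show ?case
  proof (rule runs_Mu)
    show "runs p f (y # xs) 0" using n(1) Mu.IH by simp
    show "\<forall>m<y. \<exists>z. runs p f (m # xs) (Suc z)"
      using n(2) Mu.IH by (metis One_nat_def gr0_conv_Suc less_imp_Suc_add add_Suc plus_nat.add_0)
  qed
qed (auto split: if_splits intro: runs.intros simp: length_Suc_conv)

text \<open>A single induction bounds both the use of the oracle and the fuel; determinism is a corollary.\<close>

lemma fuel_eval_if_runs:
  "runs p e xs y \<Longrightarrow> \<exists>M. \<forall>q t. (\<forall>n<M. q n = p n) \<longrightarrow> M \<le> t \<longrightarrow> fuel_eval q t e xs = Suc y"
proof (induction rule: runs.induct)
  case (runs_Query x)
  show ?case by (intro exI[of _ "Suc x"]) simp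
next
  case (runs_Comp xs gs ys f z)
  have "\<exists>M. \<forall>q t. (\<forall>n<M. q n = p n) \<longrightarrow> M \<le> t \<longrightarrow> list_all2 (\<lambda>g y. fuel_eval q t g xs = Suc y) gs ys"
    using runs_Comp.IH(1)
  proof (induction rule: list_all2_induct)
    case (Cons g gs y ys)
    then obtain M1 M2 where
      *: "\<forall>q t. (\<forall>n<M1. q n = p n) \<longrightarrow> M1 \<le> t \<longrightarrow> fuel_eval q t g xs = Suc y"
      "\<forall>q t. (\<forall>n<M2. q n = p n) \<longrightarrow> M2 \<le> t \<longrightarrow> list_all2 (\<lambda>g y. fuel_eval q t g xs = Suc y) gs ys"
      by blast
    show ?case
    proof (intro exI[of _ "max M1 M2"] allI impI)
      show "list_all2 (\<lambda>g y. fuel_eval q t g xs = Suc y) (g # gs) (y # ys)"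
        if "\<forall>n<max M1 M2. q n = p n" "max M1 M2 \<le> t" for q t
        using that *[rule_format, of q t] by simp
    qed
  qed auto
  then obtain M1 where M1: "\<And>q t. (\<forall>n<M1. q n = p n) \<Longrightarrow> M1 \<le> t \<Longrightarrow>
      list_all2 (\<lambda>g y. fuel_eval q t g xs = Suc y) gs ys"
    by blast
  obtain M2 where M2: "\<And>q t. (\<forall>n<M2. q n = p n) \<Longrightarrow> M2 \<le> t \<Longrightarrow> fuel_eval q t f ys = Suc z"
    using runs_Comp.IH(2) by blast
  show ?case
    unfolding fuel_eval_Comp_eq_Suc
    by (intro exI[of _ "max M1 M2"] allI impI exI[of _ ys] conjI M1 M2) auto
next
  case (runs_Rec_Suc f g n xs y z)
  then obtain M1 M2 where
    *: "\<forall>q t. (\<forall>n<M1. q n = p n) \<longrightarrow> M1 \<le> t \<longrightarrow> fuel_eval q t (Rec f g) (n # xs) = Suc y"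
    "\<forall>q t. (\<forall>n<M2. q n = p n) \<longrightarrow> M2 \<le> t \<longrightarrow> fuel_eval q t g (n # y # xs) = Suc z"
    by blast
  show ?case
  proof (intro exI[of _ "max M1 M2"] allI impI)
    show "fuel_eval q t (Rec f g) (Suc n # xs) = Suc z"
      if "\<forall>n<max M1 M2. q n = p n" "max M1 M2 \<le> t" for q t
      using that *[rule_format, of q t] by simp
  qed
next
  case (runs_Mu f n xs)
  obtain M where
    M: "\<forall>q t. (\<forall>n<M. q n = p n) \<longrightarrow> M \<le> t \<longrightarrow> fuel_eval q t f (n # xs) = Suc 0"
    using runs_Mu.IH(1) by blast
  have "\<exists>K. \<forall>q t. (\<forall>n<K. q n = p n) \<longrightarrow> K \<le> t \<longrightarrow> 1 < fuel_eval q t f (m # xs)" if m: "m < n" for m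
  proof -
    obtain y K where "\<forall>q t. (\<forall>n<K. q n = p n) \<longrightarrow> K \<le> t \<longrightarrow> fuel_eval q t f (m # xs) = Suc (Suc y)"
      using runs_Mu.IH(2) m by blast
    then show ?thesis by (intro exI[of _ K]) simp
  qed
  then obtain K where K: "\<And>m. m < n \<Longrightarrow>
      \<forall>q t. (\<forall>i<K m. q i = p i) \<longrightarrow> K m \<le> t \<longrightarrow> 1 < fuel_eval q t f (m # xs)"
    by metis
  \<comment> \<open>One bound for finitely many runs: \<open>M\<close> for the zero at
    \<open>n\<close>, \<open>K m\<close> for each earlier value, and \<open>Suc n\<close> because
    the search only inspects candidates below the fuel.\<close>
  let ?L = "Max (insert M (insert (Suc n) (K ` {..<n})))"
  have L: "M \<le> ?L" "Suc n \<le> ?L" "m < n \<Longrightarrow> K m \<le> ?L" for m by (rule Max_ge; simp)+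
  show ?case
    unfolding fuel_eval_Mu_eq_Suc
  proof (intro exI[of _ ?L] allI impI conjI)
    fix q :: "nat \<Rightarrow> nat" and t assume q: "\<forall>n<?L. q n = p n" and t: "?L \<le> t"
    show "n < t" using t L(2) by linarith
    show "fuel_eval q t f (n # xs) = 1" using M[rule_format, of q t] q t L(1) by simp
    show "1 < fuel_eval q t f (m # xs)" if m: "m < n" for m
      using K[OF that, rule_format, of q t] q t L(3)[OF that] by simp
  qed
qed (auto simp: fuel_eval_Mu_eq_Suc)

lemma runs_deterministic: "runs p e xs y \<Longrightarrow> runs p e xs z \<Longrightarrow> y = z"
proof -
  assume "runs p e xs y" "runs p e xs z"
  then obtain M1 M2 where
    "\<And>t. M1 \<le> t \<Longrightarrow> fuel_eval p t e xs = Suc y" "\<And>t. M2 \<le> t \<Longrightarrow> fuel_eval p t e xs = Suc z"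
    by (metis fuel_eval_if_runs)
  from this(1)[of "max M1 M2"] this(2)[of "max M1 M2"] show ?thesis by simp
qed

section \<open>Computability of the evaluation with fuel\<close>

lemma oracle_pred_Bex_set:
  "(\<And>g. g \<in> set gs \<Longrightarrow> oracle_pred v (P g)) \<Longrightarrow> oracle_pred v (\<lambda>p s. \<exists>g\<in>set gs. P g p s)"
proof (induction gs)
  case Nil
  then show ?case by (simp add: oracle_pred_def) (rule oracle_intros)
next
  case (Cons g gs)
  then have "oracle_pred v (\<lambda>p s. P g p s \<or> (\<exists>g\<in>set gs. P g p s))"
    by (intro oracle_intros) auto
  then show ?case by simp
qed

text \<open>The oracle stream of the simulated program and its fuel are computed from the parameter stored
  behind its arguments.\<close>

lemma oracle_fun_fuel_eval_args:
  assumes e: "\<And>k. oracle_fun (\<lambda>s. map s [0..<Suc k]) (\<lambda>p s. fuel_eval (q (s k)) (s k) e (map s [0..<k]))"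
    and As: "\<And>A. A \<in> set As \<Longrightarrow> oracle_fun v A" and T: "oracle_fun v T"
  shows "oracle_fun v (\<lambda>p s. fuel_eval (q (T p s)) (T p s) e (map (\<lambda>A. A p s) As))"
proof -
  let ?k = "length As"
  let ?G = "\<lambda>i. if i < ?k then As ! i else T"
  have "oracle_fun v (?G i)" for i using As T by auto
  then have "oracle_fun v (\<lambda>p s. fuel_eval (q (?G ?k p s)) (?G ?k p s) e (map (\<lambda>i. ?G i p s) [0..<?k]))"
    by (intro oracle_fun_subst[OF e, where G = ?G])
  moreover have "map (\<lambda>i. ?G i p s) [0..<?k] = map (\<lambda>A. A p s) As" for p s
    by (intro nth_equalityI) auto
  ultimately show ?thesis by simp
qed

text \<open>The simulated program \<open>e\<close> is fixed, so induction over it builds one total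
  evaluator for each \<open>e\<close> rather than a universal machine. The last entry
  \<open>s k\<close> is at once the index of the simulated stream and the fuel.\<close>

lemma oracle_fun_fuel_eval:
  assumes q: "oracle_fun (\<lambda>t. [fst t, snd t]) (\<lambda>p t. q (fst t) (snd t))"
  shows "oracle_fun (\<lambda>s. map s [0..<Suc k]) (\<lambda>p s. fuel_eval (q (s k)) (s k) e (map s [0..<k]))"
proof (induction e arbitrary: k)
  case Zero
  then show ?case by (simp del: upt_Suc) (rule oracle_intros)
next
  \<comment> \<open>The arity \<open>k\<close> is known when the evaluator is built, so tests on the
    length of the argument list are settled by a case distinction outside the computation.\<close>
  case Succ
  then show ?case
    by (cases "k = 1") (simp_all del: upt_Suc, (rule oracle_intros arg_intros lessI zero_less_Suc)+)
next
  case (Proj i)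
  then show ?case
    by (cases "i < k") (simp_all del: upt_Suc, (rule oracle_intros arg_intros less_SucI | assumption)+)
next
  case Query
  have *: "oracle_fun v A \<Longrightarrow> oracle_fun v B \<Longrightarrow> oracle_fun v (\<lambda>p s. q (A p s) (B p s))" for v :: "(nat \<Rightarrow> nat) \<Rightarrow> _" and A B
    by (rule oracle_fun_comp2[OF q])
  show ?case
    by (cases "k = 1") (simp_all del: upt_Suc, (rule * oracle_intros arg_intros lessI zero_less_Suc)+)
next
  case (Comp f gs)
  let ?v = "\<lambda>s. map s [0..<Suc k]"
  let ?g = "\<lambda>g p s. fuel_eval (q (s k)) (s k) g (map s [0..<k])"
  have "oracle_fun ?v (\<lambda>p s. fuel_eval (q (s k)) (s k) f (map (\<lambda>A. A p s) (map (\<lambda>g p s. ?g g p s - 1) gs)))"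
  proof (rule oracle_fun_fuel_eval_args[OF Comp.IH(1)])
    fix A :: "(nat \<Rightarrow> nat) \<Rightarrow> (nat \<Rightarrow> nat) \<Rightarrow> nat" assume "A \<in> set (map (\<lambda>g p s. ?g g p s - 1) gs)"
    then obtain g where "g \<in> set gs" "A = (\<lambda>p s. ?g g p s - 1)" by auto
    then show "oracle_fun ?v A" by (simp only:) (rule oracle_fun_diff Comp.IH(2) oracle_fun_const | assumption)+
  qed (intro oracle_fun_var is_arg_map lessI)
  moreover have "oracle_pred ?v (\<lambda>p s. \<exists>g\<in>set gs. ?g g p s = 0)"
    by (intro oracle_pred_Bex_set oracle_pred_eq Comp.IH oracle_fun_const)
  ultimately have "oracle_fun ?v (\<lambda>p s. if \<exists>g\<in>set gs. ?g g p s = 0 then 0 else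
      fuel_eval (q (s k)) (s k) f (map (\<lambda>A. A p s) (map (\<lambda>g p s. ?g g p s - 1) gs)))"
    by (intro oracle_fun_if oracle_fun_const)
  moreover have "0 \<in> (\<lambda>g. ?g g p s) ` set gs \<longleftrightarrow> (\<exists>g\<in>set gs. ?g g p s = 0)"
    for p :: "nat \<Rightarrow> nat" and s by force
  ultimately show ?case
    by (simp add: Let_def image_image comp_def cong: if_cong del: upt_Suc)
next
  case (Rec f g)
  show ?case
  proof (cases k)
    case 0
    then show ?thesis by (simp del: upt_Suc) (rule oracle_intros)
  next
    case (Suc k')
    let ?v = "\<lambda>s. map s [0..<Suc k]"
    let ?xs = "map (\<lambda>i s. s (Suc i)) [0..<k']"
    let ?v' = "\<lambda>t. fst (snd t) # snd (snd t) # ?v (fst t)"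
    have tl: "map s [0..<k] = s 0 # map (\<lambda>A. A s) ?xs" for s :: "nat \<Rightarrow> nat"
      unfolding Suc by (simp add: upt_conv_Cons map_Suc_upt[symmetric] comp_def del: upt_Suc)
    have f: "oracle_fun ?v (\<lambda>p s. fuel_eval (q (s k)) (s k) f (map (\<lambda>A. A p s) (map (\<lambda>A p. A) ?xs)))"
      by (rule oracle_fun_fuel_eval_args) (auto simp: Suc simp del: upt_Suc intro!: Rec.IH oracle_intros oracle_fun_var)
    let ?A = "(\<lambda>p t. fst (snd t)) # (\<lambda>p t. snd (snd t) - 1) # map (\<lambda>A p t. A (fst t)) ?xs"
    have "oracle_fun ?v' (\<lambda>p t. fuel_eval (q (fst t k)) (fst t k) g (map (\<lambda>A. A p t) ?A))"
    proof (rule oracle_fun_fuel_eval_args[OF Rec.IH(2)])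
      have s: "oracle_fun ?v' (\<lambda>p t. fst t i)" if "i < Suc k" for i
        using that by (intro oracle_fun_var is_arg_tl is_arg_map)
      have "oracle_fun ?v' (\<lambda>p t. fst (snd t))" "oracle_fun ?v' (\<lambda>p t. snd (snd t) - 1)"
        by (rule oracle_fun_diff oracle_fun_const oracle_fun_var is_arg_hd is_arg_tl)+
      then show "oracle_fun ?v' A" if "A \<in> set ?A" for A :: "(nat \<Rightarrow> nat) \<Rightarrow> (nat \<Rightarrow> nat) \<times> nat \<times> nat \<Rightarrow> nat"
        using that s Suc by (auto simp del: upt_Suc)
      show "oracle_fun ?v' (\<lambda>p t. fst t k)" by (rule s) simp
    qed
    moreover have "oracle_pred ?v' (\<lambda>p t. snd (snd t) = 0)"
      by (rule oracle_pred_eq oracle_fun_const oracle_fun_var is_arg_hd is_arg_tl)+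
    ultimately have *: "oracle_fun ?v' (\<lambda>p t. if snd (snd t) = 0 then 0 else
        fuel_eval (q (fst t k)) (fst t k) g (map (\<lambda>A. A p t) ?A))"
      by (intro oracle_fun_if oracle_fun_const)
    have "oracle_fun ?v (\<lambda>p s. rec_nat (fuel_eval (q (s k)) (s k) f (map (\<lambda>A. A p s) (map (\<lambda>A p. A) ?xs)))
        (\<lambda>m y. if y = 0 then 0 else
          fuel_eval (q (s k)) (s k) g (m # (y - 1) # map (\<lambda>A. A s) ?xs)) (s 0))"
      by (rule oracle_fun_rec[where k = "Suc k", OF _ f _ oracle_fun_var[OF is_arg_map[OF zero_less_Suc]]])
        (use * in \<open>simp_all add: comp_def arity_def del: upt_Suc cong: if_cong\<close>)
    then show ?thesis unfolding tl by (simp add: comp_def cong: if_cong del: upt_Suc)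
  qed
next
  case (Mu f)
  let ?v = "\<lambda>s. map s [0..<Suc k]"
  let ?xs = "map (\<lambda>i s. s i) [0..<k]"
  let ?E = "\<lambda>s n. fuel_eval (q (s k)) (s k) f (n # map s [0..<k])"
  \<comment> \<open>Stated for any environment \<open>w\<close> from which \<open>h\<close> recovers
    the arguments, since the value occurs under one binder (the candidate \<open>n\<close>) and
    under two (the earlier \<open>m\<close>).\<close>
  have E: "oracle_fun w (\<lambda>p t. ?E (h t) (n t))"
    if "\<And>i. i < Suc k \<Longrightarrow> is_arg w (\<lambda>t. h t i)" "is_arg w n" for w h n
  proof -
    have "oracle_fun w (\<lambda>p t. fuel_eval (q (h t k)) (h t k) f
        (map (\<lambda>A. A p t) ((\<lambda>p. n) # map (\<lambda>i p t. h t i) [0..<k])))"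
      by (rule oracle_fun_fuel_eval_args) (auto intro!: Mu.IH oracle_fun_var that simp del: upt_Suc)
    then show ?thesis by (simp add: comp_def del: upt_Suc)
  qed
  have *: "oracle_fun ?v (\<lambda>p s. if \<exists>n<s k. ?E s n = 1 \<and> (\<forall>m<n. 1 < ?E s m)
      then Suc (LEAST n. s k \<le> n \<or> ?E s n = 1) else 0)"
    by (rule oracle_intros E arg_intros exI disjI1 order_refl lessI | assumption)+
  then show ?case by (simp del: upt_Suc)
qed

section \<open>Codes and approximate distances\<close>

text \<open>Tuples with entries below \<open>b\<close> are coded in base \<open>b\<close>, which bounds the codes of all \<open>m\<close>-tuples
  by \<open>b ^ m\<close>.\<close>

definition digit :: "nat \<Rightarrow> nat \<Rightarrow> nat \<Rightarrow> nat" where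
  "digit b w j = w div b ^ j mod b"

lemma oracle_fun_digit [oracle_intros]:
  assumes "oracle_fun v A" "oracle_fun v B" "oracle_fun v C" shows "oracle_fun v (\<lambda>p s. digit (A p s) (B p s) (C p s))"
  unfolding digit_def by (rule oracle_intros assms)+

lemma ex_digits: "(\<And>j. j < m \<Longrightarrow> f j < b) \<Longrightarrow> \<exists>w<b ^ m. \<forall>j<m. digit b w j = f j"
proof (induction m arbitrary: f)
  case (Suc m)
  obtain w where w: "w < b ^ m" "\<And>j. j < m \<Longrightarrow> digit b w j = f (Suc j)"
    using Suc.IH[of "\<lambda>j. f (Suc j)"] Suc.prems by auto
  have "f 0 < b" using Suc.prems by simp
  show ?case
  proof (intro exI[of _ "f 0 + b * w"] conjI allI impI)
    have "f 0 + b * w < b * Suc w" using \<open>f 0 < b\<close> by simp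
    also have "b * Suc w \<le> b * b ^ m" using w(1) by (intro mult_le_mono2) simp
    finally show "f 0 + b * w < b ^ Suc m" by simp
    fix j assume "j < Suc m"
    have "(f 0 + b * w) div b = w" using \<open>f 0 < b\<close> by simp
    then show "digit b (f 0 + b * w) j = f j"
      using w(2) \<open>j < Suc m\<close> \<open>f 0 < b\<close>
      by (cases j) (auto simp: digit_def div_mult2_eq)
  qed
qed auto

text \<open>The absolute value of the integer coded by \<open>n\<close> is \<open>Suc n div 2\<close>, and its sign is the parity of
  \<open>n\<close>. So \<open>scaled k c\<close> is the integral part of \<open>2 ^ k\<close> times the absolute value of the rational coded
  by \<open>c\<close>, a zero denominator giving \<open>0\<close> on both sides.\<close>

definition scaled :: "nat \<Rightarrow> nat \<Rightarrow> nat" where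
  "scaled k c = 2 ^ k * (Suc (fst (prod_decode c)) div 2) div (Suc (snd (prod_decode c)) div 2)"

text \<open>Equal parities of the two integer codes mean equal signs. A negative radius is sent to
  0, so that no strict test against it from below can succeed.\<close>

definition scaled_pos :: "nat \<Rightarrow> nat \<Rightarrow> nat" where
  "scaled_pos k c =
    (if fst (prod_decode c) mod 2 = snd (prod_decode c) mod 2 then scaled k c else 0)"

lemma oracle_fun_scaled [oracle_intros]:
  assumes "oracle_fun v A" "oracle_fun v B"
  shows "oracle_fun v (\<lambda>p s. scaled (A p s) (B p s))" "oracle_fun v (\<lambda>p s. scaled_pos (A p s) (B p s))"
  unfolding scaled_pos_def scaled_def by (rule oracle_intros assms)+

lemma int_decode_even: "even n \<Longrightarrow> int_decode n = int (Suc n div 2)"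
  and int_decode_odd: "odd n \<Longrightarrow> int_decode n = - int (Suc n div 2)"
  by (auto simp: int_decode_def sum_decode_def elim!: evenE oddE)

lemma abs_int_decode: "\<bar>int_decode n\<bar> = int (Suc n div 2)"
  by (cases "even n") (simp_all add: int_decode_even int_decode_odd divide_nonpos_nonpos)

lemma real_of_nat_to_rat_surj:
  "real_of_rat (nat_to_rat_surj c) =
    of_int (int_decode (fst (prod_decode c))) / of_int (int_decode (snd (prod_decode c)))"
  by (cases "int_decode (snd (prod_decode c)) = 0")
    (simp_all add: nat_to_rat_surj_def case_prod_beta of_rat_rat rat_number_collapse)

lemma scaled_bounds:
  shows scaled_le: "real (scaled k c) \<le> 2 ^ k * \<bar>real_of_rat (nat_to_rat_surj c)\<bar>"
    and scaled_ge: "2 ^ k * \<bar>real_of_rat (nat_to_rat_surj c)\<bar> \<le> real (scaled k c) + 1"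
proof -
  let ?x = "Suc (fst (prod_decode c)) div 2" and ?y = "Suc (snd (prod_decode c)) div 2"
  have "\<bar>real_of_rat (nat_to_rat_surj c)\<bar> =
      of_int \<bar>int_decode (fst (prod_decode c))\<bar> / of_int \<bar>int_decode (snd (prod_decode c))\<bar>"
    by (simp add: real_of_nat_to_rat_surj)
  then have "\<bar>real_of_rat (nat_to_rat_surj c)\<bar> = real ?x / real ?y"
    unfolding abs_int_decode by simp
  then have "2 ^ k * \<bar>real_of_rat (nat_to_rat_surj c)\<bar> = real (2 ^ k * ?x) / real ?y"
    by simp
  moreover have "real m / real n - real (m div n) \<le> 1" for m n
    using real_of_int_div3[of "int m" "int n"] by (simp flip: zdiv_int)
  ultimately show "real (scaled k c) \<le> 2 ^ k * \<bar>real_of_rat (nat_to_rat_surj c)\<bar>"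
    and "2 ^ k * \<bar>real_of_rat (nat_to_rat_surj c)\<bar> \<le> real (scaled k c) + 1"
    using of_nat_div_le_of_nat[of "2 ^ k * ?x" ?y, where 'a = real]
    unfolding scaled_def by (metis, smt (verit))
qed

lemma nat_to_rat_surj_sign:
  "fst (prod_decode c) mod 2 = snd (prod_decode c) mod 2 \<Longrightarrow> 0 \<le> real_of_rat (nat_to_rat_surj c)"
  "fst (prod_decode c) mod 2 \<noteq> snd (prod_decode c) mod 2 \<Longrightarrow> real_of_rat (nat_to_rat_surj c) \<le> 0"
proof -
  let ?x = "fst (prod_decode c)" and ?y = "snd (prod_decode c)"
  have parity: "?x mod 2 = ?y mod 2 \<longleftrightarrow> (even ?x \<longleftrightarrow> even ?y)" by presburger
  show "0 \<le> real_of_rat (nat_to_rat_surj c)" if "?x mod 2 = ?y mod 2"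
    using that unfolding parity real_of_nat_to_rat_surj
    by (cases "even ?x"; cases "even ?y") (simp_all add: int_decode_even int_decode_odd divide_nonpos_nonpos)
  show "real_of_rat (nat_to_rat_surj c) \<le> 0" if "?x mod 2 \<noteq> ?y mod 2"
    using that unfolding parity real_of_nat_to_rat_surj
    by (cases "even ?x"; cases "even ?y")
      (simp_all add: int_decode_even int_decode_odd divide_nonneg_nonpos divide_nonpos_nonneg)
qed

text \<open>Positivity excludes the truncated case, in which the bound would fail for a negative
  rational.\<close>

lemma scaled_pos_le: "0 < scaled_pos k c \<Longrightarrow> real (scaled_pos k c) \<le> 2 ^ k * real_of_rat (nat_to_rat_surj c)"
  using scaled_le[of k c] nat_to_rat_surj_sign(1)[of c] by (auto simp: scaled_pos_def split: if_splits)

lemma scaled_pos_ge: "2 ^ k * real_of_rat (nat_to_rat_surj c) \<le> real (scaled_pos k c) + 1"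
proof (cases "fst (prod_decode c) mod 2 = snd (prod_decode c) mod 2")
  case True
  then show ?thesis using scaled_ge[of k c] nat_to_rat_surj_sign(1)[of c] by (simp add: scaled_pos_def)
next
  case False
  then have "2 ^ k * real_of_rat (nat_to_rat_surj c) \<le> 0"
    using nat_to_rat_surj_sign(2)[of c] by (simp add: mult_nonneg_nonpos)
  then show ?thesis by simp
qed

text \<open>Turns real distances into natural numbers at scale \<open>2 ^ k\<close>. Of the error 2,
  one unit comes from the rational approximation and one from rounding; taking absolute values
  cannot worsen the approximation of a nonnegative number.\<close>

lemma (in computable_polish_space) ex_scaled_dist:
  "\<exists>D. oracle_fun (\<lambda>t. [fst t, fst (snd t), snd (snd t)]) (\<lambda>p t. D (fst t) (fst (snd t)) (snd (snd t))) \<and>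
    (\<forall>i j k. \<bar>real (D i j k) - 2 ^ k * dist (a i) (a j)\<bar> \<le> 2)"
proof -
  obtain c where c: "computable_fun 3 c"
    and d: "\<And>i j k. \<bar>real_of_rat (nat_to_rat_surj (c [i, j, k])) - dist (a i) (a j)\<bar> \<le> (1 / 2) ^ k"
    using computable_dist unfolding computable_real_double_seq_def by blast
  let ?D = "\<lambda>i j k. scaled k (c [i, j, k])"
  have "oracle_fun (\<lambda>t. [fst t, fst (snd t), snd (snd t)]) (\<lambda>p t. c [fst t, fst (snd t), snd (snd t)])"
    using oracle_fun_computable_fun[OF c, of "\<lambda>t. [fst t, fst (snd t), snd (snd t)]"] by simp
  then have "oracle_fun (\<lambda>t. [fst t, fst (snd t), snd (snd t)]) (\<lambda>p t. ?D (fst t) (fst (snd t)) (snd (snd t)))"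
    \<comment> \<open>The assumption is tried before \<open>oracle_fun_var\<close>, which would also
      match the term with \<open>c\<close>.\<close>
    by - (rule oracle_fun_scaled | assumption | rule oracle_intros arg_intros)+
  moreover have "\<bar>real (?D i j k) - 2 ^ k * dist (a i) (a j)\<bar> \<le> 2" for i j k
  proof -
    let ?q = "real_of_rat (nat_to_rat_surj (c [i, j, k]))"
    have "\<bar>\<bar>?q\<bar> - dist (a i) (a j)\<bar> \<le> (1 / 2) ^ k"
      using d[of i j k] zero_le_dist[of "a i" "a j"] by linarith
    then have "2 ^ k * \<bar>\<bar>?q\<bar> - dist (a i) (a j)\<bar> \<le> 2 ^ k * (1 / 2) ^ k"
      by (intro mult_left_mono) auto
    then have "\<bar>2 ^ k * \<bar>?q\<bar> - 2 ^ k * dist (a i) (a j)\<bar> \<le> 1"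
      by (simp add: power_one_over flip: right_diff_distrib abs_mult_pos')
    then show ?thesis using scaled_le[of k "c [i, j, k]"] scaled_ge[of k "c [i, j, k]"] by linarith
  qed
  ultimately show ?thesis by (intro exI[of _ ?D] conjI allI)
qed

section \<open>Separated families\<close>

text \<open>\<open>P\<close> holds on an initial segment of the naturals, so a finite supremum is
  attained and is recognised by looking at \<open>s\<close> and \<open>Suc s\<close> alone.\<close>

lemma enat_eq_Sup_iff:
  assumes "P 0" and "\<And>m. P (Suc m) \<Longrightarrow> P m"
  shows "enat s = Sup {enat m | m. P m} \<longleftrightarrow> P s \<and> \<not> P (Suc s)"
proof -
  have le: "P m" if "P n" "m \<le> n" for m n using that(2,1) by (induction rule: inc_induct) (auto intro: assms)
  show ?thesis
  proof
    assume s: "enat s = Sup {enat m | m. P m}"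
    have "\<not> P (Suc s)"
    proof
      assume "P (Suc s)"
      then have "enat (Suc s) \<le> enat s" unfolding s by (intro Sup_upper) blast
      then show False by simp
    qed
    moreover have "P s"
    proof (rule ccontr)
      assume "\<not> P s"
      then obtain r where r: "s = Suc r" using assms(1) by (cases s) auto
      have "m \<le> r" if "P m" for m
        using le[OF that, of s] \<open>\<not> P s\<close> unfolding r by (metis not_less_eq_eq)
      then have "enat s \<le> enat r" unfolding s by (intro Sup_least) auto
      then show False by (simp add: r)
    qed
    ultimately show "P s \<and> \<not> P (Suc s)" by simp
  next
    assume s: "P s \<and> \<not> P (Suc s)"
    have "m \<le> s" if "P m" for m
      using le[OF that, of "Suc s"] s by (metis not_less_eq_eq)
    then have "Sup {enat m | m. P m} \<le> enat s" by (intro Sup_least) auto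
    moreover have "enat s \<le> Sup {enat m | m. P m}" using s by (intro Sup_upper) blast
    ultimately show "enat s = Sup {enat m | m. P m}" by (intro antisym)
  qed
qed

definition separated :: "real \<Rightarrow> nat \<Rightarrow> (nat \<Rightarrow> 'a::metric_space) \<Rightarrow> bool" where
  "separated \<theta> m x \<longleftrightarrow> (\<forall>j<m. \<forall>l<j. \<theta> < dist (x j) (x l))"

lemma separated_mono: "separated \<theta> n x \<Longrightarrow> m \<le> n \<Longrightarrow> \<theta>' \<le> \<theta> \<Longrightarrow> separated \<theta>' m x"
  unfolding separated_def by (meson le_less_trans less_le_trans)

lemma separatedD: "separated \<theta> m x \<Longrightarrow> j < m \<Longrightarrow> l < m \<Longrightarrow> j \<noteq> l \<Longrightarrow> \<theta> < dist (x j) (x l)"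
  unfolding separated_def by (metis dist_commute linorder_neqE_nat)

text \<open>Otherwise \<open>y\<close> could be appended to the family.\<close>

lemma maximal_separated:
  fixes x :: "nat \<Rightarrow> 'a::metric_space"
  assumes x: "separated \<theta> m x" and "\<And>y :: nat \<Rightarrow> 'a. \<not> separated \<theta> (Suc m) y"
  shows "\<exists>j<m. dist y (x j) \<le> \<theta>"
proof (rule ccontr)
  assume "\<not> ?thesis"
  then have "separated \<theta> (Suc m) (x(m := y))"
    using x by (auto simp: separated_def less_Suc_eq not_le)
  then show False using assms(2) by blast
qed

lemma ex_separated_iff:
  "(\<exists>x :: nat \<Rightarrow> 'a::metric_space. \<forall>j\<in>{1..m}. \<forall>k\<in>{1..m}. j \<noteq> k \<longrightarrow> dist (x j) (x k) > \<theta>)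
    \<longleftrightarrow> (\<exists>x :: nat \<Rightarrow> 'a. separated \<theta> m x)"
proof (intro iffI; elim exE)
  fix x :: "nat \<Rightarrow> 'a" assume "\<forall>j\<in>{1..m}. \<forall>k\<in>{1..m}. j \<noteq> k \<longrightarrow> dist (x j) (x k) > \<theta>"
  then have "separated \<theta> m (\<lambda>j. x (Suc j))" unfolding separated_def by auto
  then show "\<exists>x :: nat \<Rightarrow> 'a. separated \<theta> m x" by blast
next
  fix x :: "nat \<Rightarrow> 'a" assume *: "separated \<theta> m x"
  show "\<exists>x :: nat \<Rightarrow> 'a. \<forall>j\<in>{1..m}. \<forall>k\<in>{1..m}. j \<noteq> k \<longrightarrow> dist (x j) (x k) > \<theta>"
    by (intro exI[of _ "\<lambda>j. x (j - 1)"] ballI impI separatedD[OF *]) auto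
qed

lemma enat_eq_packing_number_iff:
  "enat s = Sup {enat m | m. \<exists>x :: nat \<Rightarrow> 'a::metric_space.
      \<forall>j\<in>{1..m}. \<forall>k\<in>{1..m}. j \<noteq> k \<longrightarrow> dist (x j) (x k) > \<theta>} \<longleftrightarrow>
    (\<exists>x :: nat \<Rightarrow> 'a. separated \<theta> s x) \<and> (\<forall>x :: nat \<Rightarrow> 'a. \<not> separated \<theta> (Suc s) x)"
proof -
  have "\<exists>x :: nat \<Rightarrow> 'a. separated \<theta> m x" if "\<exists>x :: nat \<Rightarrow> 'a. separated \<theta> (Suc m) x" for m
    using that separated_mono[of \<theta> "Suc m" _ m \<theta>] by auto
  moreover have "\<exists>x :: nat \<Rightarrow> 'a. separated \<theta> 0 x" by (simp add: separated_def)
  ultimately show ?thesis unfolding ex_separated_iff by (subst enat_eq_Sup_iff) auto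
qed

text \<open>Unbounded search for a zero of the negated predicate. That a halting search has really
  found a witness uses determinism of \<open>runs\<close>.\<close>

lemma semidecidable_search:
  assumes "oracle_pred (\<lambda>n. [n]) P"
  shows "\<exists>e. \<forall>p. (\<exists>y. runs p e [] y) \<longleftrightarrow> (\<exists>n. P p n)"
proof -
  have "oracle_pred (\<lambda>n. [n]) (\<lambda>p n. \<not> P p n)" by (rule oracle_intros assms)+
  then obtain f where f: "\<And>p n. runs p f [n] (of_bool (\<not> P p n))"
    by (auto simp: oracle_pred_def oracle_fun_def)
  have "(\<exists>y. runs p (Mu f) [] y) \<longleftrightarrow> (\<exists>n. P p n)" for p
  proof
    assume "\<exists>y. runs p (Mu f) [] y"
    then obtain n where "runs p f [n] 0" by (auto elim: runs.cases)
    then have "of_bool (\<not> P p n) = (0::nat)" using f runs_deterministic by blast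
    then show "\<exists>n. P p n" by auto
  next
    assume ex: "\<exists>n. P p n"
    have "runs p (Mu f) [] (LEAST n. P p n)"
    proof (rule runs_Mu)
      show "runs p f [LEAST n. P p n] 0" using f[of p "LEAST n. P p n"] LeastI_ex[OF ex] by simp
      show "\<forall>m<LEAST n. P p n. \<exists>y. runs p f [m] (Suc y)"
        using f not_less_Least by (metis One_nat_def of_bool_eq(2))
    qed
    then show "\<exists>y. runs p (Mu f) [] y" by blast
  qed
  then show ?thesis by blast
qed

section \<open>From packing numbers to compactness\<close>

text \<open>The space is complete, and totally bounded because a separated family of largest size,
  at a threshold below \<open>e\<close>, provides the centres of a cover by
  \<open>e\<close>-balls.\<close>

lemma compact_UNIV_if_packings_finite:
  fixes \<epsilon> :: "nat \<Rightarrow> real"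
  assumes pos: "\<And>i. 0 < \<epsilon> i" and lim: "\<epsilon> \<longlonglongrightarrow> 0"
    and fin: "\<And>i. \<exists>m. \<forall>x :: nat \<Rightarrow> 'a::complete_space. \<not> separated (\<epsilon> i) m x"
  shows "compact (UNIV :: 'a set)"
  unfolding compact_eq_totally_bounded
proof (intro conjI allI impI)
  show "complete (UNIV :: 'a set)" by (rule complete_UNIV)
  fix e :: real assume "0 < e"
  then obtain i where i: "\<epsilon> i < e"
    using eventually_happens'[OF sequentially_bot order_tendstoD(2)[OF lim]] by blast
  let ?P = "\<lambda>m. \<forall>x :: nat \<Rightarrow> 'a. \<not> separated (\<epsilon> i) m x"
  \<comment> \<open>The least impossible size is not 0, since the empty family is separated; its
    predecessor is the largest possible size.\<close>
  define n where "n = (LEAST m. ?P m)"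
  have n: "?P n" using fin[of i] unfolding n_def by (rule LeastI_ex)
  then have "n \<noteq> 0" by (cases n) (auto simp: separated_def)
  then obtain m where m: "n = Suc m" by (cases n) auto
  then have "\<not> ?P m" using not_less_Least[of m ?P] by (simp add: n_def)
  then obtain x :: "nat \<Rightarrow> 'a" where x: "separated (\<epsilon> i) m x" by blast
  have "UNIV \<subseteq> (\<Union>y\<in>x ` {..<m}. ball y e)"
  proof
    fix y
    obtain j where "j < m" "dist y (x j) \<le> \<epsilon> i" using maximal_separated[OF x] n m by blast
    then show "y \<in> (\<Union>y\<in>x ` {..<m}. ball y e)"
      using i by (intro UN_I[of "x j"]) (auto simp: dist_commute)
  qed
  then show "\<exists>k. finite k \<and> (UNIV :: 'a set) \<subseteq> (\<Union>x\<in>k. ball x e)" by blast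
qed

text \<open>Separation consists of finitely many strict inequalities, which survive a small enough
  move of every point into the dense set.\<close>

lemma ex_dense_separated:
  fixes a x :: "nat \<Rightarrow> 'a::metric_space"
  assumes dense: "closure (range a) = UNIV" and x: "separated \<theta> m x"
  shows "\<exists>f. separated \<theta> m (\<lambda>j. a (f j))"
proof -
  have "\<exists>g. (\<lambda>n. a (g n)) \<longlonglongrightarrow> y" for y
  proof -
    have "y \<in> closure (range a)" using dense by simp
    then obtain h where h: "\<forall>n. h n \<in> range a" "h \<longlonglongrightarrow> y" unfolding closure_sequential by blast
    then have "\<forall>n. \<exists>i. h n = a i" by blast
    then obtain g where "\<And>n. h n = a (g n)" by metis
    then have "h = (\<lambda>n. a (g n))" by blast
    with h(2) show ?thesis by blast
  qed
  then obtain g where g: "\<And>y. (\<lambda>n. a (g y n)) \<longlonglongrightarrow> y" by metis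
  have "\<forall>\<^sub>F n in sequentially. \<theta> < dist (a (g (x j) n)) (a (g (x l) n))" if "j < m" "l < j" for j l
    using x that by (intro order_tendstoD(1)[OF tendsto_dist[OF g g]]) (auto simp: separated_def)
  then have ev: "\<forall>\<^sub>F n in sequentially. \<forall>j\<in>{..<m}. \<forall>l\<in>{..<j}. \<theta> < dist (a (g (x j) n)) (a (g (x l) n))"
    by (intro eventually_ball_finite ballI) auto
  obtain n where "\<forall>j\<in>{..<m}. \<forall>l\<in>{..<j}. \<theta> < dist (a (g (x j) n)) (a (g (x l) n))"
    using eventually_happens'[OF sequentially_bot ev] by blast
  then have "separated \<theta> m (\<lambda>j. a (g (x j) n))" by (simp add: separated_def)
  then show ?thesis by (intro exI[of _ "\<lambda>j. g (x j) n"])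
qed

text \<open>A Lebesgue number argument: the first \<open>m\<close> balls, shrunk by
  \<open>1 / (m + 1)\<close>, form an increasing open cover, so by compactness a single stage covers
  everything. One number thus bounds both the indices and the margin.\<close>

lemma uniform_ball_cover:
  assumes K: "compact (UNIV :: 'a::metric_space set)" and U: "(\<Union>n. ball (c n) (r n)) = (UNIV :: 'a set)"
  shows "\<exists>m. \<forall>x. \<exists>n<m. dist x (c n) + inverse (real (Suc m)) < r n"
proof -
  define V where "V m = (\<Union>n<m. ball (c n) (r n - inverse (real (Suc m))))" for m
  have mono: "V m \<subseteq> V m'" if "m \<le> m'" for m m'
  proof -
    have "inverse (real (Suc m')) \<le> inverse (real (Suc m))" using that by (simp add: le_imp_inverse_le)
    then show ?thesis using that unfolding V_def
      by (intro UN_mono subset_ball) auto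
  qed
  have "x \<in> (\<Union>m. V m)" for x
  proof -
    obtain n where "x \<in> ball (c n) (r n)" using U by blast
    then have "0 < r n - dist (c n) x" by simp
    then obtain k where k: "inverse (real (Suc k)) < r n - dist (c n) x" using reals_Archimedean by blast
    have "inverse (real (Suc (max k (Suc n)))) \<le> inverse (real (Suc k))"
      by (simp add: le_imp_inverse_le)
    with k have "dist (c n) x < r n - inverse (real (Suc (max k (Suc n))))" by linarith
    then have "x \<in> V (max k (Suc n))" unfolding V_def by (intro UN_I[of n]) auto
    then show ?thesis by blast
  qed
  then have "UNIV \<subseteq> (\<Union>m\<in>UNIV. V m)" by blast
  moreover have "open (V m)" for m unfolding V_def by auto
  ultimately obtain C where C: "finite C" "UNIV \<subseteq> (\<Union>m\<in>C. V m)"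
    using compactE_image[OF K, of UNIV V] by metis
  have V: "UNIV \<subseteq> V (Max (insert 0 C))"
  proof
    fix x
    obtain m where "m \<in> C" "x \<in> V m" using C by blast
    moreover from this have "m \<le> Max (insert 0 C)" using C by simp
    ultimately show "x \<in> V (Max (insert 0 C))" using mono by blast
  qed
  have "\<exists>n<Max (insert 0 C). dist x (c n) + inverse (real (Suc (Max (insert 0 C)))) < r n" for x
  proof -
    obtain n where "n < Max (insert 0 C)" "x \<in> ball (c n) (r n - inverse (real (Suc (Max (insert 0 C)))))"
      using V unfolding V_def by blast
    then show ?thesis by (intro exI[of _ n]) (simp add: dist_commute)
  qed
  then show ?thesis by blast
qed

lemma computably_compact_if_packing_numbers:
  fixes a :: "nat \<Rightarrow> 'a::complete_space" and D :: "nat \<Rightarrow> nat \<Rightarrow> nat \<Rightarrow> nat"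
  assumes dense: "closure (range a) = UNIV"
    and D: "oracle_fun (\<lambda>t. [fst t, fst (snd t), snd (snd t)]) (\<lambda>p t. D (fst t) (fst (snd t)) (snd (snd t)))"
    and dist: "\<And>i j k. \<bar>real (D i j k) - 2 ^ k * dist (a i) (a j)\<bar> \<le> 2"
    and c: "computable_nat_seq c" and s: "computable_nat_seq s"
    and \<epsilon>: "\<And>i. \<epsilon> i = real_of_rat (nat_to_rat_surj (c i))"
    and pos: "\<And>i. 0 < \<epsilon> i" and lim: "\<epsilon> \<longlonglongrightarrow> 0"
    and packing: "\<And>i. \<exists>x :: nat \<Rightarrow> 'a. separated (\<epsilon> i) (s i) x"
      "\<And>i x. \<not> separated (\<epsilon> i) (Suc (s i)) (x :: nat \<Rightarrow> 'a)"
  shows "computably_compact a"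
proof -
  \<comment> \<open>The added 1 makes \<open>E\<close> round upwards, so that it bounds the scaled
    threshold from above.\<close>
  define E where "E i k = scaled k (c i) + 1" for i k
  have E: "2 ^ k * \<epsilon> i \<le> real (E i k)" "real (E i k) \<le> 2 ^ k * \<epsilon> i + 1" for i k
    using scaled_ge[of k "c i"] scaled_le[of k "c i"] pos[of i] unfolding E_def \<epsilon> by auto
  define ctr where "ctr n = fst (prod_decode n)" for n
  define rad where "rad n = snd (prod_decode n)" for n
  \<comment> \<open>The slack 2 absorbs the error of \<open>D\<close>, so these integer tests imply
    the real inequalities. By the triangle inequality, \<open>cov\<close> puts each closed ball of
    radius \<open>\<epsilon> i\<close> into a listed ball.\<close>
  define sep where "sep B i k w \<longleftrightarrow>
    (\<forall>j<s i. \<forall>l<j. E i k + 2 < D (digit B w j) (digit B w l) k)" for B i k w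
  define cov where "cov p B i k w \<longleftrightarrow> (\<forall>j<s i. \<exists>n<B.
    D (digit B w j) (ctr (p n)) k + E i k + 2 < scaled_pos k (rad (p n)))" for p B i k w
  \<comment> \<open>A single \<open>B\<close> bounds the index, the precision, the dense points and
    the part of the list that is read; hence the search runs over one number.\<close>
  define found where "found p B \<longleftrightarrow> (\<exists>i<B. \<exists>k<B. \<exists>w<B ^ s i. sep B i k w \<and> cov p B i k w)" for p B
  have "oracle_pred (\<lambda>n. [n]) found"
    unfolding found_def sep_def cov_def E_def ctr_def rad_def
    by (rule oracle_intros oracle_fun_comp3[OF D] oracle_fun_computable_nat_seq[OF c] oracle_fun_computable_nat_seq[OF s] arg_intros)+
  then obtain e where e: "\<And>p. (\<exists>y. runs p e [] y) \<longleftrightarrow> (\<exists>B. found p B)"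
    using semidecidable_search by blast
  have ball: "rational_ball a n = ball (a (ctr n)) (real_of_rat (nat_to_rat_surj (rad n)))" for n
    by (simp add: rational_ball_def ctr_def rad_def case_prod_beta)
  have "named_open a p = UNIV" if found: "found p B" for p B
  proof -
    obtain i k w where sep: "sep B i k w" and cov: "cov p B i k w"
      using found unfolding found_def by blast
    let ?y = "\<lambda>j. a (digit B w j)"
    have "separated (\<epsilon> i) (s i) ?y"
      unfolding separated_def
    proof (intro allI impI)
      fix j l assume "j < s i" "l < j"
      then have "real (E i k) + 2 < real (D (digit B w j) (digit B w l) k)"
        using sep unfolding sep_def by (metis of_nat_add of_nat_less_iff of_nat_numeral)
      then have "2 ^ k * \<epsilon> i < 2 ^ k * dist (?y j) (?y l)"
        using dist[of "digit B w j" "digit B w l" k] E(1)[of k i] by linarith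
      then show "\<epsilon> i < dist (?y j) (?y l)" by simp
    qed
    then have near: "\<exists>j<s i. dist x (?y j) \<le> \<epsilon> i" for x
      using maximal_separated packing(2) by blast
    have "x \<in> named_open a p" for x
    proof -
      obtain j where j: "j < s i" "dist x (?y j) \<le> \<epsilon> i" using near by blast
      obtain n where "D (digit B w j) (ctr (p n)) k + E i k + 2 < scaled_pos k (rad (p n))"
        using cov j(1) unfolding cov_def by blast
      then have n: "real (D (digit B w j) (ctr (p n)) k) + real (E i k) + 2 < real (scaled_pos k (rad (p n)))"
        and "0 < scaled_pos k (rad (p n))"
        by linarith+
      have "2 ^ k * dist x (a (ctr (p n))) \<le> 2 ^ k * (dist x (?y j) + dist (?y j) (a (ctr (p n))))"
        by (intro mult_left_mono dist_triangle) simp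
      also have "\<dots> \<le> 2 ^ k * \<epsilon> i + 2 ^ k * dist (?y j) (a (ctr (p n)))"
        using j(2) by (simp add: distrib_left)
      also have "\<dots> < real (scaled_pos k (rad (p n)))"
        using n dist[of "digit B w j" "ctr (p n)" k] E(1)[of k i] by linarith
      also have "\<dots> \<le> 2 ^ k * real_of_rat (nat_to_rat_surj (rad (p n)))"
        using \<open>0 < scaled_pos k (rad (p n))\<close> by (rule scaled_pos_le)
      finally have "x \<in> rational_ball a (p n)" by (simp add: ball dist_commute)
      then show ?thesis unfolding named_open_def by blast
    qed
    then show ?thesis by blast
  qed
  moreover have "\<exists>B. found p B" if U: "named_open a p = UNIV" for p
  proof -
    define r where "r n = real_of_rat (nat_to_rat_surj (rad (p n)))" for n
    have "compact (UNIV :: 'a set)"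
      using compact_UNIV_if_packings_finite[OF pos lim] packing(2) by blast
    moreover have "(\<Union>n. ball (a (ctr (p n))) (r n)) = UNIV"
      using U by (simp add: named_open_def ball r_def)
    ultimately obtain m where m: "\<And>x. \<exists>n<m. dist x (a (ctr (p n))) + inverse (real (Suc m)) < r n"
      using uniform_ball_cover[of "\<lambda>n. a (ctr (p n))" r] by metis
    \<comment> \<open>Half of the covering margin: one half pays for the threshold
      \<open>\<epsilon> i\<close>, the other for the numerical errors.\<close>
    define \<gamma> where "\<gamma> = inverse (real (Suc m)) / 2"
    have "0 < \<gamma>" by (simp add: \<gamma>_def)
    then obtain i where i: "\<epsilon> i < \<gamma>"
      using eventually_happens'[OF sequentially_bot order_tendstoD(2)[OF lim]] by blast
    obtain x :: "nat \<Rightarrow> 'a" where "separated (\<epsilon> i) (s i) x" using packing(1) by blast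
    then obtain f where f: "separated (\<epsilon> i) (s i) (\<lambda>j. a (f j))"
      using ex_dense_separated[OF dense] by metis
    \<comment> \<open>The 6 is the total loss in \<open>cov\<close>: 2 from \<open>D\<close>, 1 from
      \<open>E\<close>, the slack 2, and 1 from rounding the radius. The loss in \<open>sep\<close>
      is smaller.\<close>
    have "(\<lambda>k. 6 * (1 / 2) ^ k :: real) \<longlonglongrightarrow> 6 * 0"
      by (intro tendsto_intros) simp
    then have lim6: "(\<lambda>k. 6 * (1 / 2) ^ k :: real) \<longlonglongrightarrow> 0" by simp
    have small: "\<forall>\<^sub>F k in sequentially. 6 * (1 / 2) ^ k < \<delta>" if "0 < \<delta>" for \<delta> :: real
      using order_tendstoD(2)[OF lim6 that] .
    have ev: "\<forall>\<^sub>F k in sequentially. 6 * (1 / 2) ^ k < \<gamma> \<and>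
        (\<forall>j\<in>{..<s i}. \<forall>l\<in>{..<j}. 6 * (1 / 2) ^ k < dist (a (f j)) (a (f l)) - \<epsilon> i)"
      using f unfolding separated_def
      by (intro eventually_conj eventually_ball_finite ballI small \<open>0 < \<gamma>\<close>) auto
    obtain k where k: "6 * (1 / 2) ^ k < \<gamma>"
      "\<And>j l. j < s i \<Longrightarrow> l < j \<Longrightarrow> 6 * (1 / 2) ^ k < dist (a (f j)) (a (f l)) - \<epsilon> i"
      using eventually_happens'[OF sequentially_bot ev] by (elim exE conjE) simp
    have up: "6 + 2 ^ k * u < 2 ^ k * v" if "6 * (1 / 2) ^ k < v - u" for u v :: real
    proof -
      have "2 ^ k * (6 * (1 / 2) ^ k) < 2 ^ k * (v - u)" using that by (intro mult_strict_left_mono) auto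
      then show ?thesis by (simp add: power_one_over algebra_simps)
    qed
    \<comment> \<open>The sum makes every \<open>f j\<close> a legal digit in base
      \<open>B\<close>.\<close>
    define B where "B = Suc (i + k + m + (\<Sum>j<s i. f j))"
    have "i < B" "k < B" "m < B" by (auto simp: B_def)
    have "f j < B" if "j < s i" for j
      using member_le_sum[of j "{..<s i}" f] that by (auto simp: B_def)
    then obtain w where w: "w < B ^ s i" "\<And>j. j < s i \<Longrightarrow> digit B w j = f j"
      using ex_digits[of "s i" f B] by auto
    have "sep B i k w"
      unfolding sep_def
    proof (intro allI impI)
      fix j l assume jl: "j < s i" "l < j"
      have "real (E i k + 2) < real (D (f j) (f l) k)"
        using up[OF k(2)[OF jl]] E(2)[of i k] dist[of "f j" "f l" k] by simp
      then show "E i k + 2 < D (digit B w j) (digit B w l) k" using w(2) jl by simp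
    qed
    moreover have "cov p B i k w"
      unfolding cov_def
    proof (intro allI impI)
      fix j assume j: "j < s i"
      obtain n where n: "n < m" "dist (a (f j)) (a (ctr (p n))) + inverse (real (Suc m)) < r n"
        using m by blast
      have "6 * (1 / 2) ^ k < r n - (\<epsilon> i + dist (a (f j)) (a (ctr (p n))))"
        using n(2) i k(1) unfolding \<gamma>_def by linarith
      from up[OF this] have "6 + (2 ^ k * \<epsilon> i + 2 ^ k * dist (a (f j)) (a (ctr (p n)))) < 2 ^ k * r n"
        by (simp add: distrib_left)
      then have "real (D (f j) (ctr (p n)) k + E i k + 2) < real (scaled_pos k (rad (p n)))"
        using scaled_pos_ge[of k "rad (p n)"] E(2)[of i k] dist[of "f j" "ctr (p n)" k]
        unfolding r_def by simp
      then show "\<exists>n<B. D (digit B w j) (ctr (p n)) k + E i k + 2 < scaled_pos k (rad (p n))"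
        using n(1) \<open>m < B\<close> w(2)[OF j] by (intro exI[of _ n]) simp
    qed
    ultimately show ?thesis
      unfolding found_def using \<open>i < B\<close> \<open>k < B\<close> w(1) by blast
  qed
  ultimately have "(\<exists>y. runs p e [] y) \<longleftrightarrow> named_open a p \<in> {U. open U \<and> U = UNIV}" for p
    unfolding e by auto
  then show ?thesis
    unfolding computably_compact_def semidecidable_open_sets_def by blast
qed

section \<open>From compactness to packing numbers\<close>

text \<open>A nonnegative integer \<open>n\<close> has the code \<open>2 * n\<close>, so numerator
  and denominator are both doubled.\<close>

lemma real_of_rat_dyadic:
  "real_of_rat (nat_to_rat_surj (prod_encode (2 * t, 2 * 2 ^ k))) = real t / 2 ^ k"
proof -
  have "even (2 * 2 ^ k :: nat)" "even (2 * t)" by simp_all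
  then show ?thesis
    unfolding real_of_nat_to_rat_surj prod_encode_inverse fst_conv snd_conv
    by (simp add: int_decode_even)
qed

lemma oracle_fun_fuel_eval_nullary:
  assumes "oracle_fun (\<lambda>t. [fst t, snd t]) (\<lambda>p t. q (fst t) (snd t))" "oracle_fun v T"
  shows "oracle_fun v (\<lambda>p s. fuel_eval (q (T p s)) (T p s) e [])"
  using oracle_fun_fuel_eval_args[OF oracle_fun_fuel_eval[OF assms(1)], of "[]" v T e] assms(2) by simp

text \<open>A cut-off list names an open set inside the union of its first \<open>n\<close> balls,
  so its acceptance proves that their centres form a net. Finite use of the oracle guarantees that
  some cut-off is accepted.\<close>

lemma computable_nets:
  fixes a :: "nat \<Rightarrow> 'a::metric_space"
  assumes dense: "closure (range a) = UNIV" and "computably_compact a"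
  shows "\<exists>N. oracle_fun (\<lambda>k. [k]) (\<lambda>p. N) \<and> (\<forall>k x. \<exists>j<N k. dist x (a j) < 1 / 2 ^ k)"
proof -
  have "named_open a p \<in> {U. open U \<and> U = UNIV} \<longleftrightarrow> named_open a p = UNIV" for p by auto
  then obtain e where e: "\<And>p. (\<exists>y. runs p e [] y) \<longleftrightarrow> named_open a p = UNIV"
    using assms(2) unfolding computably_compact_def semidecidable_open_sets_def by metis
  define net where "net k n = prod_encode (n, prod_encode (2, 2 * 2 ^ k))" for k n :: nat
  have rational_ball_net: "rational_ball a (net k n) = ball (a n) (1 / 2 ^ k)" for k n
    using real_of_rat_dyadic[of 1 k] by (simp add: rational_ball_def net_def)
  \<comment> \<open>\<open>0\<close> is the code of an empty ball, so only finitely many balls of the net are listed.\<close>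
  define q where "q z n = (if n < snd (prod_decode z) then net (fst (prod_decode z)) n else 0)" for z n
  \<comment> \<open>The code of \<open>(k, n)\<close> serves as stream index and as fuel; being at
    least \<open>n\<close>, it provides enough fuel once \<open>n\<close> is large.\<close>
  define halts where "halts k n \<longleftrightarrow> fuel_eval (q (prod_encode (k, n))) (prod_encode (k, n)) e [] \<noteq> 0" for k n
  have "prod_decode 0 = (0, 0)" by (simp add: prod_decode_def prod_decode_aux.simps)
  then have "rational_ball a 0 = {}"
    by (simp add: rational_ball_def nat_to_rat_surj_def int_decode_even rat_number_collapse)
  then have named: "named_open a (q (prod_encode (k, n))) \<subseteq> (\<Union>j<n. ball (a j) (1 / 2 ^ k))" for k n
    unfolding named_open_def q_def by (auto simp: rational_ball_net split: if_splits)
  have "oracle_fun (\<lambda>t. [fst t, snd t]) (\<lambda>p t. q (fst t) (snd t))"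
    unfolding q_def net_def by (rule oracle_intros arg_intros)+
  note oracle_fun_fuel_eval_q = oracle_fun_fuel_eval_nullary[OF this]
  have halts: "\<exists>n. halts k n" for k
  proof -
    have "named_open a (net k) = UNIV"
    proof -
      have "\<exists>n. x \<in> ball (a n) (1 / 2 ^ k)" for x
      proof -
        have "x \<in> closure (range a)" using dense by simp
        moreover have "(0::real) < 1 / 2 ^ k" by simp
        ultimately show ?thesis unfolding closure_approachable by (metis imageE mem_ball)
      qed
      then show ?thesis unfolding named_open_def rational_ball_net by blast
    qed
    then obtain y where "runs (net k) e [] y" using e by blast
    then obtain M where "\<forall>q t. (\<forall>n<M. q n = net k n) \<longrightarrow> M \<le> t \<longrightarrow> fuel_eval q t e [] = Suc y"
      using fuel_eval_if_runs by blast
    moreover have "M \<le> prod_encode (k, M)" by (rule le_prod_encode_2)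
    ultimately have "fuel_eval (q (prod_encode (k, M))) (prod_encode (k, M)) e [] = Suc y"
      by (auto simp: q_def)
    then show ?thesis unfolding halts_def by (intro exI[of _ M]) simp
  qed
  define N where "N k = (LEAST n. halts k n)" for k
  have "oracle_fun (\<lambda>k. [k]) (\<lambda>p. N)"
    unfolding N_def halts_def
    by (rule halts[unfolded halts_def] oracle_fun_fuel_eval_q oracle_intros arg_intros)+
  moreover have "\<exists>j<N k. dist x (a j) < 1 / 2 ^ k" for k x
  proof -
    have "halts k (N k)" unfolding N_def using halts by (rule LeastI_ex)
    then obtain y where "runs (q (prod_encode (k, N k))) e [] y"
      unfolding halts_def by (metis not0_implies_Suc runs_if_fuel_eval)
    then have "x \<in> named_open a (q (prod_encode (k, N k)))" using e by blast
    then have "x \<in> (\<Union>j<N k. ball (a j) (1 / 2 ^ k))" using named by blast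
    then show ?thesis by (auto simp: dist_commute)
  qed
  ultimately show ?thesis by blast
qed

text \<open>Start from a threshold below \<open>h\<close> at which the packing number is least.\<close>

lemma packing_number_locally_constant:
  assumes h: "0 < h" and fin: "\<And>\<theta>. 0 < \<theta> \<Longrightarrow> \<exists>m. \<forall>x :: nat \<Rightarrow> 'a::metric_space. \<not> separated \<theta> m x"
  shows "\<exists>\<theta>0 m. 0 < \<theta>0 \<and> \<theta>0 < h \<and> (\<forall>\<theta>. \<theta>0 \<le> \<theta> \<longrightarrow> \<theta> < h \<longrightarrow>
    (\<exists>x :: nat \<Rightarrow> 'a. separated \<theta> m x) \<and> (\<forall>x :: nat \<Rightarrow> 'a. \<not> separated \<theta> (Suc m) x))"
proof -
  define P where "P \<theta> m \<longleftrightarrow> (\<forall>x :: nat \<Rightarrow> 'a. \<not> separated \<theta> (Suc m) x)" for \<theta> m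
  \<comment> \<open>\<open>R m\<close> says that \<open>m\<close> bounds the packing number at some
    threshold below \<open>h\<close>.\<close>
  define R where "R m \<longleftrightarrow> (\<exists>\<theta>. 0 < \<theta> \<and> \<theta> < h \<and> P \<theta> m)" for m
  obtain m0 where "\<forall>x :: nat \<Rightarrow> 'a. \<not> separated (h / 2) m0 x" using fin[of "h / 2"] h by auto
  then have "P (h / 2) m0" unfolding P_def using separated_mono[of "h / 2" "Suc m0" _ m0 "h / 2"] by auto
  then have "R m0" unfolding R_def using h by (intro exI[of _ "h / 2"]) simp
  define m where "m = (LEAST m. R m)"
  have "R m" unfolding m_def using \<open>R m0\<close> by (rule LeastI)
  then obtain \<theta>0 where \<theta>0: "0 < \<theta>0" "\<theta>0 < h" "P \<theta>0 m" unfolding R_def by blast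
  have "(\<exists>x :: nat \<Rightarrow> 'a. separated \<theta> m x) \<and> P \<theta> m" if \<theta>: "\<theta>0 \<le> \<theta>" "\<theta> < h" for \<theta>
  proof
    show "P \<theta> m"
      using \<theta>0(3) separated_mono[OF _ order_refl \<theta>(1)] unfolding P_def by blast
    show "\<exists>x :: nat \<Rightarrow> 'a. separated \<theta> m x"
    proof (cases m)
      case 0
      then show ?thesis by (simp add: separated_def)
    next
      case (Suc m')
      then have "\<not> R m'" using not_less_Least[of m' R] by (simp add: m_def)
      \<comment> \<open>If no \<open>m\<close> points were separated at \<open>\<theta>\<close>,
        then \<open>\<theta>\<close> itself would witness \<open>R m'\<close>, against minimality of
        \<open>m\<close>.\<close>
      then show ?thesis using \<theta> \<theta>0(1) unfolding R_def P_def Suc by force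
    qed
  qed
  then show ?thesis using \<theta>0 unfolding P_def by blast
qed

lemma packing_numbers_if_computably_compact:
  fixes a :: "nat \<Rightarrow> 'a::metric_space" and D :: "nat \<Rightarrow> nat \<Rightarrow> nat \<Rightarrow> nat"
  assumes dense: "closure (range a) = UNIV"
    and D: "oracle_fun (\<lambda>t. [fst t, fst (snd t), snd (snd t)]) (\<lambda>p t. D (fst t) (fst (snd t)) (snd (snd t)))"
    and dist: "\<And>i j k. \<bar>real (D i j k) - 2 ^ k * dist (a i) (a j)\<bar> \<le> 2"
    and compact: "computably_compact a"
  shows "\<exists>c s. computable_nat_seq c \<and> computable_nat_seq s \<and>
    (\<forall>i. 0 < real_of_rat (nat_to_rat_surj (c i)) \<and>
      real_of_rat (nat_to_rat_surj (c i)) \<le> (1 / 2) ^ i \<and>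
      (\<exists>x :: nat \<Rightarrow> 'a. separated (real_of_rat (nat_to_rat_surj (c i))) (s i) x) \<and>
      (\<forall>x :: nat \<Rightarrow> 'a. \<not> separated (real_of_rat (nat_to_rat_surj (c i))) (Suc (s i)) x))"
proof -
  obtain N where oracle_fun_N: "oracle_fun (\<lambda>k. [k]) (\<lambda>p. N)"
    and N: "\<And>k x. \<exists>j<N k. dist x (a j) < 1 / 2 ^ k"
    using computable_nets[OF dense compact] by blast
  have codes: "\<exists>w<N k ^ m. \<forall>j<m. dist (x j) (a (digit (N k) w j)) < 1 / 2 ^ k" for k m and x :: "nat \<Rightarrow> 'a"
  proof -
    have "\<forall>j. \<exists>i. i < N k \<and> dist (x j) (a i) < 1 / 2 ^ k" using N by blast
    then obtain f where f: "\<And>j. f j < N k \<and> dist (x j) (a (f j)) < 1 / 2 ^ k" by metis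
    then obtain w where "w < N k ^ m" "\<forall>j<m. digit (N k) w j = f j"
      using ex_digits[of m f "N k"] by auto
    then show ?thesis using f by (intro exI[of _ w]) auto
  qed
  \<comment> \<open>Both tests range over tuples of net points. The slack 2 in \<open>lower\<close>
    is the error of \<open>D\<close>; the 4 in \<open>upper\<close> adds 2 for moving two arbitrary
    points to the net, each by less than \<open>1 / 2 ^ k\<close>.\<close>
  define lower where "lower k t s \<longleftrightarrow> (\<exists>w<N k ^ s. \<forall>j<s. \<forall>l<j.
    t + 2 < D (digit (N k) w j) (digit (N k) w l) k)" for k t s
  define upper where "upper k t s \<longleftrightarrow> (\<forall>w<N k ^ Suc s. \<exists>j<Suc s. \<exists>l<j.
    D (digit (N k) w j) (digit (N k) w l) k + 4 \<le> t)" for k t s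
  have scale: "r < 2 + 2 ^ k * d" if "r / 2 ^ k < 1 / 2 ^ k + d + 1 / 2 ^ k" for r d :: real and k
  proof -
    have "2 ^ k * (r / 2 ^ k) < 2 ^ k * (1 / 2 ^ k + d + 1 / 2 ^ k)"
      using that by (intro mult_strict_left_mono) auto
    then show ?thesis by (simp add: distrib_left)
  qed
  have lower: "\<exists>x :: nat \<Rightarrow> 'a. separated (real t / 2 ^ k) s x" if low: "lower k t s" for k t s
  proof -
    obtain w where w: "\<And>j l. j < s \<Longrightarrow> l < j \<Longrightarrow> t + 2 < D (digit (N k) w j) (digit (N k) w l) k"
      using low unfolding lower_def by blast
    have "real t / 2 ^ k < dist (a (digit (N k) w j)) (a (digit (N k) w l))" if "j < s" "l < j" for j l
    proof -
      have "real t < 2 ^ k * dist (a (digit (N k) w j)) (a (digit (N k) w l))"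
        using w[OF that] dist[of "digit (N k) w j" "digit (N k) w l" k] by linarith
      then show ?thesis by (simp add: field_simps)
    qed
    then have "separated (real t / 2 ^ k) s (\<lambda>j. a (digit (N k) w j))" by (simp add: separated_def)
    then show ?thesis by (intro exI[of _ "\<lambda>j. a (digit (N k) w j)"])
  qed
  have upper: "\<not> separated (real t / 2 ^ k) (Suc s) x" if up: "upper k t s" for k t s and x :: "nat \<Rightarrow> 'a"
  proof
    assume x: "separated (real t / 2 ^ k) (Suc s) x"
    obtain w where w: "w < N k ^ Suc s" "\<And>j. j < Suc s \<Longrightarrow> dist (x j) (a (digit (N k) w j)) < 1 / 2 ^ k"
      using codes by blast
    let ?y = "\<lambda>j. a (digit (N k) w j)"
    obtain j l where jl: "j < Suc s" "l < j" "D (digit (N k) w j) (digit (N k) w l) k + 4 \<le> t"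
      using up w(1) unfolding upper_def by blast
    have "real t / 2 ^ k < dist (x j) (x l)" using x jl unfolding separated_def by blast
    also have "\<dots> \<le> dist (x j) (?y j) + dist (?y j) (?y l) + dist (x l) (?y l)" by metric
    also have "\<dots> < 1 / 2 ^ k + dist (?y j) (?y l) + 1 / 2 ^ k"
      using w(2)[of j] w(2)[of l] jl by simp
    finally have "real t < 2 + 2 ^ k * dist (?y j) (?y l)" by (rule scale)
    then show False using jl(3) dist[of "digit (N k) w j" "digit (N k) w l" k] by linarith
  qed
  \<comment> \<open>Partial converse: the 6 is the slack 2 of the test, 2 for the move to the net
    and 2 for the error of \<open>D\<close>.\<close>
  have lowerI: "lower k t s" if x: "separated (real (t + 6) / 2 ^ k) s x" for k t s and x :: "nat \<Rightarrow> 'a"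
  proof -
    obtain w where w: "w < N k ^ s" "\<And>j. j < s \<Longrightarrow> dist (x j) (a (digit (N k) w j)) < 1 / 2 ^ k"
      using codes by blast
    let ?y = "\<lambda>j. a (digit (N k) w j)"
    have "t + 2 < D (digit (N k) w j) (digit (N k) w l) k" if jl: "j < s" "l < j" for j l
    proof -
      have "real (t + 6) / 2 ^ k < dist (x j) (x l)" using x jl unfolding separated_def by blast
      also have "\<dots> \<le> dist (x j) (?y j) + dist (?y j) (?y l) + dist (x l) (?y l)" by metric
      also have "\<dots> < 1 / 2 ^ k + dist (?y j) (?y l) + 1 / 2 ^ k"
        using w(2)[of j] w(2)[of l] jl by simp
      finally have "real (t + 6) < 2 + 2 ^ k * dist (?y j) (?y l)" by (rule scale)
      then show ?thesis using dist[of "digit (N k) w j" "digit (N k) w l" k] by linarith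
    qed
    then show ?thesis unfolding lower_def using w(1) by blast
  qed
  \<comment> \<open>If the test fails, net points themselves form a separated family; here 6 is the
    4 of the test plus the error 2 of \<open>D\<close>.\<close>
  have upperI: "upper k t s" if sep: "\<And>x :: nat \<Rightarrow> 'a. \<not> separated ((real t - 6) / 2 ^ k) (Suc s) x" for k t s
    unfolding upper_def
  proof (intro allI impI, rule ccontr)
    fix w
    assume *: "\<not> (\<exists>j<Suc s. \<exists>l<j. D (digit (N k) w j) (digit (N k) w l) k + 4 \<le> t)"
    have "(real t - 6) / 2 ^ k < dist (a (digit (N k) w j)) (a (digit (N k) w l))"
      if "j < Suc s" "l < j" for j l
    proof -
      have "t < D (digit (N k) w j) (digit (N k) w l) k + 4" using * that by (meson not_le)
      then have "real t - 6 < 2 ^ k * dist (a (digit (N k) w j)) (a (digit (N k) w l))"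
        using dist[of "digit (N k) w j" "digit (N k) w l" k] by linarith
      then show ?thesis by (simp add: field_simps)
    qed
    then have "separated ((real t - 6) / 2 ^ k) (Suc s) (\<lambda>j. a (digit (N k) w j))"
      by (simp add: separated_def)
    then show False using sep by blast
  qed
  \<comment> \<open>Pigeonhole: among \<open>Suc (N k)\<close> points two share a net point, hence
    are closer than \<open>2 / 2 ^ k\<close>.\<close>
  have fin: "\<exists>m. \<forall>x :: nat \<Rightarrow> 'a. \<not> separated \<theta> m x" if "0 < \<theta>" for \<theta>
  proof -
    have "\<exists>k. (1 / 2) ^ k < \<theta> / 2" using that by (intro real_arch_pow_inv) auto
    then obtain k where k: "2 * (1 / 2) ^ k < \<theta>" by (auto simp: mult.commute)
    have "\<not> separated \<theta> (Suc (N k)) x" for x :: "nat \<Rightarrow> 'a"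
    proof
      assume x: "separated \<theta> (Suc (N k)) x"
      have "\<forall>j. \<exists>i. i < N k \<and> dist (x j) (a i) < 1 / 2 ^ k" using N by blast
      then obtain f where f: "\<And>j. f j < N k" "\<And>j. dist (x j) (a (f j)) < 1 / 2 ^ k" by metis
      have "\<not> inj_on f {..<Suc (N k)}"
        using f(1) card_inj_on_le[of f "{..<Suc (N k)}" "{..<N k}"] by auto
      then obtain j l where jl: "j < Suc (N k)" "l < Suc (N k)" "j \<noteq> l" "f j = f l"
        unfolding inj_on_def by auto
      have "dist (x j) (x l) \<le> dist (x j) (a (f j)) + dist (x l) (a (f j))" by metric
      also have "\<dots> < 2 * (1 / 2) ^ k"
        using f(2)[of j] f(2)[of l] jl(4) by (simp add: power_one_over)
      finally show False using separatedD[OF x jl(1-3)] k by linarith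
    qed
    then show ?thesis by blast
  qed
  \<comment> \<open>A candidate \<open>u\<close> codes the scale \<open>k\<close>, the numerator \<open>t\<close> of the threshold \<open>t / 2 ^ k\<close> and the packing number.\<close>
  define K where "K u = fst (prod_decode u)" for u
  define T where "T u = fst (prod_decode (snd (prod_decode u)))" for u
  define S where "S u = snd (prod_decode (snd (prod_decode u)))" for u
  \<comment> \<open>\<open>T u * 2 ^ i \<le> 2 ^ K u\<close> says in integers that the threshold is
    at most \<open>1 / 2 ^ i\<close>, which forces convergence to 0.\<close>
  define good where "good i u \<longleftrightarrow> 0 < T u \<and> T u * 2 ^ i \<le> 2 ^ K u \<and>
    lower (K u) (T u) (S u) \<and> upper (K u) (T u) (S u)" for i u
  have ex_good: "\<exists>u. good i u" for i
  proof -
    define h :: real where "h = (1 / 2) ^ i"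
    have "0 < h" by (simp add: h_def)
    from packing_number_locally_constant[OF this fin] obtain \<theta>0 m where \<theta>0: "0 < \<theta>0" "\<theta>0 < h"
      and m: "\<And>\<theta>. \<theta>0 \<le> \<theta> \<Longrightarrow> \<theta> < h \<Longrightarrow>
        (\<exists>x :: nat \<Rightarrow> 'a. separated \<theta> m x) \<and> (\<forall>x :: nat \<Rightarrow> 'a. \<not> separated \<theta> (Suc m) x)"
      by metis
    \<comment> \<open>At scale \<open>2 ^ k\<close> the whole window from \<open>t - 6\<close> to
      \<open>t + 6\<close> must fit into the interval of constancy. Rounding puts
      \<open>t - 6\<close> at most 1 above its left end, so a length above 13 is enough.\<close>
    have "\<exists>k. (1 / 2) ^ k < (h - \<theta>0) / 14" using \<theta>0 by (intro real_arch_pow_inv) auto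
    then obtain k where "(1 / 2) ^ k < (h - \<theta>0) / 14" by blast
    then have k: "14 < 2 ^ k * (h - \<theta>0)" by (simp add: field_simps power_one_over)
    define t where "t = nat \<lfloor>2 ^ k * \<theta>0\<rfloor> + 7"
    have "0 \<le> 2 ^ k * \<theta>0" using \<theta>0 by simp
    then have t: "2 ^ k * \<theta>0 < real t - 6" "real t \<le> 2 ^ k * \<theta>0 + 7"
      unfolding t_def by linarith+
    then have lo: "\<theta>0 \<le> (real t - 6) / 2 ^ k" by (simp add: field_simps)
    have hi: "real (t + 6) / 2 ^ k < h" using t k by (simp add: field_simps)
    have "\<theta>0 \<le> real (t + 6) / 2 ^ k" "(real t - 6) / 2 ^ k < h"
      using lo hi by (simp_all add: field_simps)
    then have "lower k t m" "upper k t m" using m lo hi lowerI upperI by blast+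
    moreover have "0 < t" by (simp add: t_def)
    moreover have "t * 2 ^ i \<le> 2 ^ k"
    proof -
      have "real t / 2 ^ k \<le> real (t + 6) / 2 ^ k" by (intro divide_right_mono) auto
      then have "real t / 2 ^ k < 1 / 2 ^ i" using hi by (simp add: h_def power_one_over)
      then have "real (t * 2 ^ i) \<le> real (2 ^ k)" by (simp add: field_simps)
      then show ?thesis by linarith
    qed
    ultimately have "good i (prod_encode (k, prod_encode (t, m)))"
      by (simp add: good_def K_def T_def S_def)
    then show ?thesis by blast
  qed
  \<comment> \<open>Any accepted candidate is correct, whether or not it lies in an interval of
    constancy: \<open>lower\<close> and \<open>upper\<close> certify the exact packing
    number.\<close>
  define u where "u i = (LEAST u. good i u)" for i
  have good: "good i (u i)" for i unfolding u_def using ex_good by (rule LeastI_ex)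
  have oracle_fun_u: "oracle_fun (\<lambda>i. [i]) (\<lambda>p. u)"
    unfolding u_def good_def lower_def upper_def K_def T_def S_def
    by (rule oracle_intros oracle_fun_comp1[OF oracle_fun_N] oracle_fun_comp3[OF D] arg_intros
        ex_good[unfolded good_def lower_def upper_def K_def T_def S_def])+
  define c where "c i = prod_encode (2 * T (u i), 2 * 2 ^ K (u i))" for i
  have c: "real_of_rat (nat_to_rat_surj (c i)) = real (T (u i)) / 2 ^ K (u i)" for i
    unfolding c_def by (rule real_of_rat_dyadic)
  have "computable_nat_seq c"
    unfolding c_def T_def K_def by (rule computable_nat_seqI) (rule oracle_fun_u oracle_intros arg_intros)+
  moreover have "computable_nat_seq (\<lambda>i. S (u i))"
    unfolding S_def by (rule computable_nat_seqI) (rule oracle_fun_u oracle_intros arg_intros)+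
  moreover have "0 < real_of_rat (nat_to_rat_surj (c i))" for i
    unfolding c using good[of i] by (simp add: good_def)
  moreover have "real_of_rat (nat_to_rat_surj (c i)) \<le> (1 / 2) ^ i" for i
  proof -
    have "real (T (u i) * 2 ^ i) \<le> real (2 ^ K (u i))" using good[of i] unfolding good_def of_nat_le_iff by blast
    then show ?thesis unfolding c by (simp add: field_simps power_one_over)
  qed
  moreover have "\<exists>x :: nat \<Rightarrow> 'a. separated (real_of_rat (nat_to_rat_surj (c i))) (S (u i)) x" for i
    unfolding c using good[of i] lower by (simp add: good_def)
  moreover have "\<not> separated (real_of_rat (nat_to_rat_surj (c i))) (Suc (S (u i))) x" for i and x :: "nat \<Rightarrow> 'a"
    unfolding c using good[of i] upper by (simp add: good_def)
  ultimately show ?thesis by (intro exI[of _ c] exI[of _ "\<lambda>i. S (u i)"]) blast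
qed

section \<open>The equivalence, assembled from the two directions\<close>

theorem theorem5:
  fixes a :: "nat \<Rightarrow> 'a::complete_space"
  assumes "computable_polish_space a"
  shows "computably_compact a \<longleftrightarrow>
    (\<exists>(\<epsilon> :: nat \<Rightarrow> rat) (s :: nat \<Rightarrow> nat).
      computable_rat_seq \<epsilon> \<and> computable_nat_seq s \<and>
      (\<forall>i. \<epsilon> i > 0) \<and>
      (\<lambda>i. real_of_rat (\<epsilon> i)) \<longlonglongrightarrow> 0 \<and>
      (\<forall>i. enat (s i) =
        Sup {enat m | m. \<exists>x :: nat \<Rightarrow> 'a.
          \<forall>j\<in>{1..m}. \<forall>k\<in>{1..m}. j \<noteq> k \<longrightarrow> dist (x j) (x k) > real_of_rat (\<epsilon> i)}))"
  unfolding enat_eq_packing_number_iff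
proof -
  interpret computable_polish_space a by fact
  obtain D where D:
      "oracle_fun (\<lambda>t. [fst t, fst (snd t), snd (snd t)]) (\<lambda>p t. D (fst t) (fst (snd t)) (snd (snd t)))"
    and dist: "\<And>i j k. \<bar>real (D i j k) - 2 ^ k * dist (a i) (a j)\<bar> \<le> 2"
    using ex_scaled_dist by blast
  show "computably_compact a \<longleftrightarrow> (\<exists>(\<epsilon> :: nat \<Rightarrow> rat) s.
      computable_rat_seq \<epsilon> \<and> computable_nat_seq s \<and> (\<forall>i. \<epsilon> i > 0) \<and>
      (\<lambda>i. real_of_rat (\<epsilon> i)) \<longlonglongrightarrow> 0 \<and>
      (\<forall>i. (\<exists>x :: nat \<Rightarrow> 'a. separated (real_of_rat (\<epsilon> i)) (s i) x) \<and>
        (\<forall>x :: nat \<Rightarrow> 'a. \<not> separated (real_of_rat (\<epsilon> i)) (Suc (s i)) x)))"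
    (is "_ \<longleftrightarrow> (\<exists>\<epsilon> s. ?P \<epsilon> s)")
  proof
    assume "computably_compact a"
    then obtain c s where c: "computable_nat_seq c" and s: "computable_nat_seq s"
      and pos: "\<And>i. 0 < real_of_rat (nat_to_rat_surj (c i))"
      and le: "\<And>i. real_of_rat (nat_to_rat_surj (c i)) \<le> (1 / 2) ^ i"
      and packing: "\<And>i. (\<exists>x :: nat \<Rightarrow> 'a. separated (real_of_rat (nat_to_rat_surj (c i))) (s i) x) \<and>
        (\<forall>x :: nat \<Rightarrow> 'a. \<not> separated (real_of_rat (nat_to_rat_surj (c i))) (Suc (s i)) x)"
      using packing_numbers_if_computably_compact[OF dense D dist] by metis
    have "(\<lambda>i. real_of_rat (nat_to_rat_surj (c i))) \<longlonglongrightarrow> 0"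
    proof (rule tendsto_sandwich[where f = "\<lambda>_. 0" and h = "\<lambda>i. (1 / 2) ^ i"])
      show "(\<lambda>i. (1 / 2 :: real) ^ i) \<longlonglongrightarrow> 0" by (rule LIMSEQ_power_zero) simp
      show "\<forall>\<^sub>F i in sequentially. 0 \<le> real_of_rat (nat_to_rat_surj (c i))"
        by (intro always_eventually allI less_imp_le pos)
      show "\<forall>\<^sub>F i in sequentially. real_of_rat (nat_to_rat_surj (c i)) \<le> (1 / 2) ^ i"
        by (intro always_eventually allI le)
    qed (rule tendsto_const)
    moreover have "computable_rat_seq (\<lambda>i. nat_to_rat_surj (c i))"
      unfolding computable_rat_seq_def using c by blast
    ultimately have "?P (\<lambda>i. nat_to_rat_surj (c i)) s"
      using s packing pos[unfolded zero_less_of_rat_iff] by blast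
    then show "\<exists>\<epsilon> s. ?P \<epsilon> s" by (intro exI)
  next
    assume "\<exists>\<epsilon> s. ?P \<epsilon> s"
    then obtain \<epsilon> s where P: "?P \<epsilon> s" by (elim exE)
    then obtain c where c: "computable_nat_seq c" "\<And>i. \<epsilon> i = nat_to_rat_surj (c i)"
      unfolding computable_rat_seq_def by blast
    show "computably_compact a"
    proof (rule computably_compact_if_packing_numbers[OF dense D dist c(1)])
      show "computable_nat_seq s" "(\<lambda>i. real_of_rat (\<epsilon> i)) \<longlonglongrightarrow> 0" using P by blast+
      show "0 < real_of_rat (\<epsilon> i)" for i using P by simp
      show "\<exists>x :: nat \<Rightarrow> 'a. separated (real_of_rat (\<epsilon> i)) (s i) x" for i using P by blast
      show "\<not> separated (real_of_rat (\<epsilon> i)) (Suc (s i)) x" for i and x :: "nat \<Rightarrow> 'a" using P by blast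
    qed (simp add: c(2))
  qed
qed

end
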